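(* Let $F$ and $G$ be fixed nonempty graphs without isolated vertices. Then $\mathrm{ex}_F(n,G)=\Theta(n^2)$ (as $n\to\infty$) if and only if there is no graph homomorphism from $G$ to $F$; and if there is a homomorphism from $G$ to $F$, then $\mathrm{ex}_F(n,G)=o(n^2)$.
   Context: All graphs are simple. For graphs $F,G$ and a positive integer $n$, $\mathrm{ex}_F(n,G)$ is the maximum $k$ such that there exist $k$ pairwise edge-disjoint subgraphs $F_1,\dots,F_k$ of the complete graph $K_n$, each isomorphic to $F$, such that the union $\bigcup_{i=1}^k F_i$ contains no subgraph isomorphic to $G$ all of whose edges lie in pairwise distinct $F_i$'s (i.e. no copy $G'$ of $G$ with $|E(G')\cap E(F_i)|\le 1$ for all $i$). Equivalently, colouring each $F_i$ with its own colour, no "multicolor" (rainbow) copy of $G$ appears. *)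

theory Defs
  imports Complex_Main "HOL-Library.Landau_Symbols"
begin

datatype 'a graph = Graph (verts: "'a set") (edges: "'a set set")

definition simple_graph :: "'a graph \<Rightarrow> bool" where
  "simple_graph H \<longleftrightarrow> finite (verts H) \<and> edges H \<subseteq> {e. e \<subseteq> verts H \<and> card e = 2}"

definition isolated :: "'a \<Rightarrow> 'a graph \<Rightarrow> bool" where
  "isolated v H \<longleftrightarrow> v \<in> verts H \<and> (\<forall>e\<in>edges H. v \<notin> e)"

definition complete_graph :: "nat \<Rightarrow> nat graph" where
  "complete_graph n = Graph {..<n} {e. e \<subseteq> {..<n} \<and> card e = 2}"

definition subgraph :: "'a graph \<Rightarrow> 'a graph \<Rightarrow> bool" where
  "subgraph H K \<longleftrightarrow> simple_graph H \<and> verts H \<subseteq> verts K \<and> edges H \<subseteq> edges K"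

definition isomorphic :: "'a graph \<Rightarrow> 'b graph \<Rightarrow> bool" where
  "isomorphic H K \<longleftrightarrow> (\<exists>f. bij_betw f (verts H) (verts K) \<and>
     (\<forall>u\<in>verts H. \<forall>v\<in>verts H. {u, v} \<in> edges H \<longleftrightarrow> {f u, f v} \<in> edges K))"

definition graph_hom :: "('a \<Rightarrow> 'b) \<Rightarrow> 'a graph \<Rightarrow> 'b graph \<Rightarrow> bool" where
  "graph_hom f H K \<longleftrightarrow> f ` verts H \<subseteq> verts K \<and>
     (\<forall>u v. {u, v} \<in> edges H \<longrightarrow> {f u, f v} \<in> edges K)"

definition homomorphic_to :: "'a graph \<Rightarrow> 'b graph \<Rightarrow> bool" where
  "homomorphic_to H K \<longleftrightarrow> (\<exists>f. graph_hom f H K)"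

definition graph_Union :: "nat \<Rightarrow> (nat \<Rightarrow> 'a graph) \<Rightarrow> 'a graph" where
  "graph_Union k Fs = Graph (\<Union>i<k. verts (Fs i)) (\<Union>i<k. edges (Fs i))"

definition packing :: "'a graph \<Rightarrow> nat \<Rightarrow> nat \<Rightarrow> (nat \<Rightarrow> nat graph) \<Rightarrow> bool" where
  "packing F n k Fs \<longleftrightarrow>
     (\<forall>i<k. subgraph (Fs i) (complete_graph n) \<and> isomorphic F (Fs i)) \<and>
     (\<forall>i<k. \<forall>j<k. i \<noteq> j \<longrightarrow> edges (Fs i) \<inter> edges (Fs j) = {})"

definition has_multicolor_copy :: "nat \<Rightarrow> (nat \<Rightarrow> nat graph) \<Rightarrow> 'b graph \<Rightarrow> bool" where
  "has_multicolor_copy k Fs G \<longleftrightarrow>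
     (\<exists>G'. subgraph G' (graph_Union k Fs) \<and> isomorphic G G' \<and>
        (\<forall>i<k. card (edges G' \<inter> edges (Fs i)) \<le> 1))"

definition multicolor_ex :: "'a graph \<Rightarrow> nat \<Rightarrow> 'b graph \<Rightarrow> nat" where
  "multicolor_ex F n G =
     Max {k. \<exists>Fs. packing F n k Fs \<and> \<not> has_multicolor_copy k Fs G}"

text \<open>The maximum above is taken over a finite nonempty set as soon as both graphs have an edge,
  so \<^const>\<open>Max\<close> is well defined in all cases of interest.\<close>

lemma isomorphic_has_edge:
  assumes "isomorphic H K" "simple_graph H" "edges H \<noteq> {}"
  shows "edges K \<noteq> {}"
proof -
  obtain e where e: "e \<in> edges H" using assms(3) by blast
  then have "e \<subseteq> verts H" "card e = 2" using assms(2) by (auto simp: simple_graph_def)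
  then obtain u v where "e = {u, v}" "u \<in> verts H" "v \<in> verts H"
    by (auto simp: card_2_iff)
  with e assms(1) show ?thesis unfolding isomorphic_def by blast
qed

lemma multicolor_ex_set_nonempty:
  assumes "simple_graph G" "edges G \<noteq> {}"
  shows "0 \<in> {k. \<exists>Fs. packing F n k Fs \<and> \<not> has_multicolor_copy k Fs G}"
  using isomorphic_has_edge[OF _ assms]
  by (auto simp: packing_def has_multicolor_copy_def subgraph_def graph_Union_def)

lemma multicolor_ex_set_finite:
  assumes "simple_graph F" "edges F \<noteq> {}"
  shows "finite {k. \<exists>Fs. packing F n k Fs \<and> \<not> has_multicolor_copy k Fs G}"
proof -
  let ?E = "edges (complete_graph n)"
  have fin: "finite ?E"
    by (rule finite_subset[of _ "Pow {..<n}"]) (auto simp: complete_graph_def)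
  have "k \<le> card ?E" if p: "packing F n k Fs" for k Fs
  proof -
    define g where "g i = (SOME e. e \<in> edges (Fs i))" for i
    have g: "g i \<in> edges (Fs i)" if "i < k" for i
    proof -
      have "isomorphic F (Fs i)" using p that by (simp add: packing_def)
      from isomorphic_has_edge[OF this assms] show ?thesis
        unfolding g_def by (simp add: some_in_eq)
    qed
    have "inj_on g {..<k}"
    proof (rule inj_onI, rule ccontr)
      fix i j assume ij: "i \<in> {..<k}" "j \<in> {..<k}" "g i = g j" "i \<noteq> j"
      then have "g i \<in> edges (Fs i) \<inter> edges (Fs j)" using g[of i] g[of j] by auto
      moreover have "edges (Fs i) \<inter> edges (Fs j) = {}"
        using p ij unfolding packing_def by simp
      ultimately show False by simp
    qed
    moreover have "g ` {..<k} \<subseteq> ?E"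
    proof
      fix e assume "e \<in> g ` {..<k}"
      then obtain i where i: "i < k" "e = g i" by auto
      then have "edges (Fs i) \<subseteq> ?E" using p by (simp add: packing_def subgraph_def)
      with g[OF i(1)] i(2) show "e \<in> ?E" by auto
    qed
    ultimately have "card {..<k} \<le> card ?E" by (rule card_inj_on_le[OF _ _ fin])
    then show ?thesis by simp
  qed
  then have "{k. \<exists>Fs. packing F n k Fs \<and> \<not> has_multicolor_copy k Fs G} \<subseteq> {..card ?E}"
    by blast
  then show ?thesis by (rule finite_subset) simp
qed

end

(* If G maps to F, take at least eta n^2 edge-disjoint copies of F and apply Szemeredi's regularity
   lemma to their union. Fewer than eta n^2 edges lie in irregular or sparse pairs or meet a small
   part, so some copy F_i avoids all of them. Sending each vertex g of G to the part of the vertex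
   phi(g) of F_i, for a homomorphism phi, the counting lemma gives at least c n^|V(G)| homomorphic
   images of G. Only O(n^(|V(G)|-1)) maps x have an edge e and a vertex s not in e of G such that
   x(s) lies in the copy containing x(e), and every other homomorphic image is an injective
   multicolor copy.
   If G does not map to F, it suffices to find c n^2 edge-disjoint copies of F inside a blow-up
   of F: put the j-th vertex of copy (a, b) at position a + j b of the j-th part; two of these
   lines meet at most once. *)
theory Submission imports Defs "HOL-Library.FuncSet" "HOL-Analysis.Convex"
begin

section \<open>The regularity lemma\<close>

text \<open>A homomorphism may identify vertices of \<open>G\<close>, so several of them can be sent
  into the same part. This is why maps are counted instead of embeddings; injectivity is recovered
  only at the end, by the same exclusion that makes the image multicolor. One intact copy is enough
  because it locates at once all the parts and dense regular pairs that the homomorphism asks for,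
  and it exists because each discarded pair of vertices spoils at most one of the edge-disjoint
  copies. Regularity errors are measured against the sizes of whole parts and weighted by pairs of
  vertices, so they simply add up in the counting and the parts need no equalisation. The excluded
  maps lose a full factor n because x(e) determines its copy, which has only |V(F)| vertices to
  offer for x(s). In the other direction the difficulty is to pack quadratically many copies while
  the union still maps to F. Parts of |V(F)| m positions hold every line with intercept and slope
  below m as a line of integers, without wraparound, so neither a finite field nor a prime m is
  involved.\<close>

definition avg :: "'z set \<Rightarrow> ('z \<Rightarrow> 'l) \<Rightarrow> ('z \<Rightarrow> real) \<Rightarrow> 'z \<Rightarrow> real" where
  "avg Z c w z = (\<Sum>u\<in>{u\<in>Z. c u = c z}. w u) / card {u\<in>Z. c u = c z}"

text \<open>\<open>avg Z c w\<close> is the conditional expectation of \<open>w\<close> given the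
  label \<open>c\<close>. A test function of the label is constant on each fibre, where averaging
  does not change the sum.\<close>

lemma sum_avg:
  assumes "finite Z"
  shows "(\<Sum>z\<in>Z. avg Z c w z * h (c z)) = (\<Sum>z\<in>Z. w z * h (c z))"
proof -
  have "(\<Sum>z\<in>{z\<in>Z. c z = l}. avg Z c w z * h (c z)) = (\<Sum>z\<in>{z\<in>Z. c z = l}. w z * h (c z))"
    if l: "l \<in> c ` Z" for l
  proof -
    let ?N = "{z\<in>Z. c z = l}"
    have "card ?N \<noteq> 0" using l assms by auto
    have "(\<Sum>z\<in>?N. avg Z c w z * h (c z)) = (\<Sum>z\<in>?N. (\<Sum>u\<in>?N. w u) / card ?N * h l)"
      by (rule sum.cong) (auto simp: avg_def)
    also have "\<dots> = (\<Sum>u\<in>?N. w u) * h l"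
      using \<open>card ?N \<noteq> 0\<close> by simp
    also have "\<dots> = (\<Sum>z\<in>?N. w z * h (c z))"
      unfolding sum_distrib_right by (rule sum.cong) auto
    finally show ?thesis .
  qed
  then show ?thesis
    unfolding sum.image_gen[OF assms, of "\<lambda>z. avg Z c w z * h (c z)" c]
      sum.image_gen[OF assms, of "\<lambda>z. w z * h (c z)" c]
    by (rule sum.cong[OF refl])
qed

lemma avg_bounds:
  assumes "\<And>z. z \<in> Z \<Longrightarrow> 0 \<le> w z \<and> w z \<le> 1"
  shows "0 \<le> avg Z c w z" "avg Z c w z \<le> 1"
proof -
  let ?N = "{u\<in>Z. c u = c z}"
  have "(\<Sum>u\<in>?N. w u) \<le> (\<Sum>u\<in>?N. 1)" by (rule sum_mono) (use assms in auto)
  then show "avg Z c w z \<le> 1" unfolding avg_def by (simp add: divide_le_eq)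
  show "0 \<le> avg Z c w z" unfolding avg_def using assms by (auto intro!: divide_nonneg_nonneg sum_nonneg)
qed

text \<open>Averaging over fibres is an orthogonal projection. The coarse average is a function of
  the fine label through \<open>r\<close>, so \<open>sum_avg\<close> turns the mixed term into the
  coarse square sum. This identity converts a change of densities into a gain of energy.\<close>

lemma avg_pythagoras:
  assumes "finite Z" and refines: "\<And>z. z \<in> Z \<Longrightarrow> c z = r (c' z)"
  shows "(\<Sum>z\<in>Z. (avg Z c' w z - avg Z c w z)\<^sup>2)
    = (\<Sum>z\<in>Z. (avg Z c' w z)\<^sup>2) - (\<Sum>z\<in>Z. (avg Z c w z)\<^sup>2)"
proof -
  define A where "A l = (\<Sum>u\<in>{u\<in>Z. c u = l}. w u) / card {u\<in>Z. c u = l}" for l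
  have A: "avg Z c w z = A (c z)" for z by (simp add: A_def avg_def)
  have "(\<Sum>z\<in>Z. avg Z c' w z * avg Z c w z) = (\<Sum>z\<in>Z. avg Z c' w z * A (r (c' z)))"
    using refines by (intro sum.cong) (auto simp: A)
  also have "\<dots> = (\<Sum>z\<in>Z. w z * A (r (c' z)))"
    by (rule sum_avg[OF assms(1), where h = "\<lambda>l. A (r l)"])
  also have "\<dots> = (\<Sum>z\<in>Z. w z * A (c z))" using refines by (intro sum.cong) auto
  also have "\<dots> = (\<Sum>z\<in>Z. avg Z c w z * A (c z))" by (rule sum_avg[OF assms(1), symmetric])
  also have "\<dots> = (\<Sum>z\<in>Z. avg Z c w z * avg Z c w z)" by (simp only: A)
  finally have "(\<Sum>z\<in>Z. avg Z c' w z * avg Z c w z) = (\<Sum>z\<in>Z. (avg Z c w z)\<^sup>2)"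
    by (simp add: power2_eq_square)
  moreover have "(\<Sum>z\<in>Z. (avg Z c' w z - avg Z c w z)\<^sup>2) = (\<Sum>z\<in>Z. (avg Z c' w z)\<^sup>2)
    + (\<Sum>z\<in>Z. (avg Z c w z)\<^sup>2) - 2 * (\<Sum>z\<in>Z. avg Z c' w z * avg Z c w z)"
    unfolding sum_distrib_left sum.distrib[symmetric] sum_subtractf[symmetric]
    by (rule sum.cong) (simp_all add: power2_diff)
  ultimately show ?thesis by simp
qed

text \<open>A family \<open>\<S>\<close> of vertex sets stands for the partition into its Venn atoms. Thus a partition is refined by
  enlarging \<open>\<S>\<close>, and it has at most \<open>2 ^ card \<S>\<close> parts.\<close>

definition lab :: "'v set set \<Rightarrow> 'v \<Rightarrow> 'v set set" where
  "lab \<S> x = {S\<in>\<S>. x \<in> S}"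

definition atom :: "'v set \<Rightarrow> 'v set set \<Rightarrow> 'v \<Rightarrow> 'v set" where
  "atom V \<S> x = {y\<in>V. lab \<S> y = lab \<S> x}"

definition density :: "('v \<times> 'v \<Rightarrow> real) \<Rightarrow> 'v set \<Rightarrow> 'v set \<Rightarrow> real" where
  "density w P Q = sum w (P \<times> Q) / (card P * card Q)"

text \<open>The error is compared with all of \<open>P \<times> Q\<close>, whatever the sizes of
  \<open>A\<close> and \<open>B\<close>: this is a cut-norm bound on \<open>w\<close> minus its
  density, the form that fits counting with additive errors.\<close>

definition regular :: "('v \<times> 'v \<Rightarrow> real) \<Rightarrow> real \<Rightarrow> 'v set \<Rightarrow> 'v set \<Rightarrow> bool" where
  "regular w \<epsilon> P Q \<longleftrightarrow> (\<forall>A\<subseteq>P. \<forall>B\<subseteq>Q.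
     \<bar>sum w (A \<times> B) - density w P Q * (card A * card B)\<bar> \<le> \<epsilon> * (card P * card Q))"

definition lab2 :: "'v set set \<Rightarrow> 'v \<times> 'v \<Rightarrow> 'v set set \<times> 'v set set" where
  "lab2 \<S> z = (lab \<S> (fst z), lab \<S> (snd z))"

lemma fibre_lab2: "{u\<in>V \<times> V. lab2 \<S> u = lab2 \<S> (x, y)} = atom V \<S> x \<times> atom V \<S> y"
  by (auto simp: lab2_def atom_def)

lemma avg_lab2: "avg (V \<times> V) (lab2 \<S>) w (x, y) = density w (atom V \<S> x) (atom V \<S> y)"
  unfolding avg_def fibre_lab2 density_def by (simp add: card_cartesian_product)

lemma atom_eq: "y \<in> atom V \<S> x \<Longrightarrow> atom V \<S> y = atom V \<S> x"
  by (auto simp: atom_def)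

lemma atom_self: "x \<in> V \<Longrightarrow> x \<in> atom V \<S> x"
  by (auto simp: atom_def)

lemma card_atoms:
  assumes "finite \<S>"
  shows "finite (atom V \<S> ` V)" "card (atom V \<S> ` V) \<le> 2 ^ card \<S>"
proof -
  have eq: "atom V \<S> ` V = (\<lambda>l. {y\<in>V. lab \<S> y = l}) ` (lab \<S> ` V)"
    by (auto simp: atom_def)
  have sub: "lab \<S> ` V \<subseteq> Pow \<S>" by (auto simp: lab_def)
  then have fin: "finite (lab \<S> ` V)" using assms finite_subset by blast
  then show "finite (atom V \<S> ` V)" unfolding eq by simp
  have "card (atom V \<S> ` V) \<le> card (lab \<S> ` V)" unfolding eq using fin by (rule card_image_le)
  also have "\<dots> \<le> card (Pow \<S>)" using sub assms by (intro card_mono) auto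
  finally show "card (atom V \<S> ` V) \<le> 2 ^ card \<S>" using assms by (simp add: card_Pow)
qed

text \<open>By \<open>avg_lab2\<close>, these are the squared densities of the pairs of atoms,
  weighted by their numbers of vertex pairs. There is no normalisation, so for weights in [0, 1] the
  bound is the square of \<open>card V\<close>.\<close>

definition energy :: "'v set \<Rightarrow> ('v \<times> 'v \<Rightarrow> real) \<Rightarrow> 'v set set \<Rightarrow> real" where
  "energy V w \<S> = (\<Sum>z\<in>V \<times> V. (avg (V \<times> V) (lab2 \<S>) w z)\<^sup>2)"

text \<open>Irregularity is counted by pairs of vertices rather than pairs of parts, so that the parts need not
  have equal size.\<close>

definition irregular_pairs :: "'v set \<Rightarrow> ('v \<times> 'v \<Rightarrow> real) \<Rightarrow> real \<Rightarrow> 'v set set \<Rightarrow> ('v \<times> 'v) set" where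
  "irregular_pairs V w \<epsilon> \<S> =
     {z\<in>V \<times> V. \<not> regular w \<epsilon> (atom V \<S> (fst z)) (atom V \<S> (snd z))}"

text \<open>Since \<open>\<S>'\<close> contains both witnesses, averaging over its atoms preserves
  the sum of \<open>w\<close> over \<open>A \<times> B\<close>, whereas the old average is the
  constant density of \<open>(P, Q)\<close> there. The two averages therefore differ by a large sum
  on \<open>A \<times> B\<close>, and Cauchy-Schwarz makes this a large square sum.\<close>

lemma irregular_pair_gain:
  fixes \<epsilon> :: real
  assumes "finite V" and AB: "A \<subseteq> P" "B \<subseteq> Q" "A \<in> \<S>'" "B \<in> \<S>'"
    and PQ: "P = atom V \<S> x" "Q = atom V \<S> y" "x \<in> V" "y \<in> V"
    and irr: "\<bar>sum w (A \<times> B) - density w P Q * (card A * card B)\<bar> > \<epsilon> * (card P * card Q)"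
    and "\<epsilon> > 0"
  shows "\<epsilon>\<^sup>2 * (card P * card Q) \<le>
    (\<Sum>z\<in>P \<times> Q. (avg (V \<times> V) (lab2 \<S>') w z - avg (V \<times> V) (lab2 \<S>) w z)\<^sup>2)"
proof -
  let ?d = "avg (V \<times> V) (lab2 \<S>) w" and ?d' = "avg (V \<times> V) (lab2 \<S>') w"
  let ?p = "real (card P * card Q)"
  have sub: "P \<subseteq> V" "Q \<subseteq> V" by (auto simp: PQ atom_def)
  then have fin: "finite P" "finite Q" using assms(1) finite_subset by auto
  then have fin': "finite A" "finite B" using AB finite_subset by auto
  have "x \<in> P" "y \<in> Q" using PQ by (auto simp: atom_def)
  then have pos: "?p > 0" using fin by (auto simp: card_gt_0_iff simp flip: of_nat_mult)
  \<comment> \<open>The indicator of \<open>A \<times> B\<close>, read off the label alone, so that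
    \<open>sum_avg\<close> applies to it.\<close>
  define h where "h l = (of_bool (A \<in> fst l \<and> B \<in> snd l) :: real)" for l
  have h: "h (lab2 \<S>' z) = of_bool (z \<in> A \<times> B)" if "z \<in> V \<times> V" for z
    using that AB by (auto simp: h_def lab2_def lab_def)
  have restrict: "(\<Sum>z\<in>V \<times> V. f z * h (lab2 \<S>' z)) = sum f (A \<times> B)" for f
  proof -
    have "(\<Sum>z\<in>V \<times> V. f z * h (lab2 \<S>' z)) = (\<Sum>z\<in>V \<times> V. if z \<in> A \<times> B then f z else 0)"
      by (rule sum.cong) (auto simp: h)
    also have "\<dots> = sum f ((V \<times> V) \<inter> (A \<times> B))" using assms(1) by (simp add: sum.inter_restrict)
    also have "(V \<times> V) \<inter> (A \<times> B) = A \<times> B" using AB sub by auto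
    finally show ?thesis .
  qed
  have s': "sum ?d' (A \<times> B) = sum w (A \<times> B)"
    using sum_avg[of "V \<times> V" "lab2 \<S>'" w h] assms(1) by (simp add: restrict)
  have "?d z = density w P Q" if zPQ: "z \<in> P \<times> Q" for z
  proof -
    obtain a b where z: "z = (a, b)" "a \<in> P" "b \<in> Q" using zPQ by (rule SigmaE)
    then have "atom V \<S> a = P" "atom V \<S> b = Q" using PQ by (auto simp: atom_eq)
    then show ?thesis by (simp add: z avg_lab2)
  qed
  then have "sum ?d (A \<times> B) = (\<Sum>z\<in>A \<times> B. density w P Q)"
    using AB by (intro sum.cong) auto
  then have s: "sum ?d (A \<times> B) = density w P Q * (card A * card B)"
    by (simp add: card_cartesian_product)
  have "\<epsilon> * ?p \<le> \<bar>\<Sum>z\<in>A \<times> B. ?d' z - ?d z\<bar>"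
    using irr by (simp add: sum_subtractf s s')
  then have "(\<epsilon> * ?p)\<^sup>2 \<le> (\<Sum>z\<in>A \<times> B. ?d' z - ?d z)\<^sup>2"
    unfolding power2_abs[of "\<Sum>z\<in>A \<times> B. ?d' z - ?d z", symmetric]
    using \<open>\<epsilon> > 0\<close> by (intro power_mono) auto
  also have "\<dots> \<le> (\<Sum>z\<in>A \<times> B. (?d' z - ?d z)\<^sup>2) * card (A \<times> B)"
    using sum_squared_le_sum_of_squares[of "\<lambda>z. ?d' z - ?d z" "A \<times> B"] fin' by simp
  \<comment> \<open>Both factors are enlarged to \<open>P \<times> Q\<close>, so that one factor
    \<open>?p\<close> cancels at the end.\<close>
  also have "\<dots> \<le> (\<Sum>z\<in>P \<times> Q. (?d' z - ?d z)\<^sup>2) * card (P \<times> Q)"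
  proof (intro mult_mono sum_mono2)
    show "real (card (A \<times> B)) \<le> real (card (P \<times> Q))"
      unfolding of_nat_le_iff using AB fin by (intro card_mono) auto
  qed (use AB fin in \<open>auto intro: sum_nonneg\<close>)
  also have "(\<epsilon> * ?p)\<^sup>2 = (\<epsilon>\<^sup>2 * ?p) * ?p" by (simp only: power2_eq_square ac_simps)
  finally have "(\<epsilon>\<^sup>2 * ?p) * ?p \<le> (\<Sum>z\<in>P \<times> Q. (?d' z - ?d z)\<^sup>2) * ?p"
    unfolding card_cartesian_product .
  then show ?thesis using pos by (rule mult_right_le_imp_le)
qed

text \<open>The witnesses of all irregular pairs of atoms are added at once: two sets for each of at
  most \<open>4 ^ card \<S>\<close> pairs. Every vertex pair counted as irregular then contributes
  \<open>\<epsilon>\<^sup>2\<close>, and there are more than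
  \<open>\<epsilon> * (card V)\<^sup>2\<close> of them.\<close>

lemma energy_increment:
  fixes \<epsilon> :: real
  assumes "finite V" "finite \<S>" "\<epsilon> > 0"
    and many: "card (irregular_pairs V w \<epsilon> \<S>) > \<epsilon> * (card V)\<^sup>2"
  obtains \<S>' where "finite \<S>'" "card \<S>' \<le> card \<S> + 2 * 4 ^ card \<S>"
    "energy V w \<S>' \<ge> energy V w \<S> + \<epsilon> ^ 3 * (card V)\<^sup>2"
proof -
  let ?At = "atom V \<S> ` V"
  define wit where "wit P Q C \<longleftrightarrow> fst C \<subseteq> P \<and> snd C \<subseteq> Q \<and>
    \<bar>sum w (fst C \<times> snd C) - density w P Q * (card (fst C) * card (snd C))\<bar> > \<epsilon> * (card P * card Q)"
    for P Q and C :: "'a set \<times> 'a set"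
  \<comment> \<open>For a regular pair the choice is arbitrary; it costs only the two sets already
    counted.\<close>
  define C where "C P Q = (SOME C. wit P Q C)" for P Q
  have C: "wit P Q (C P Q)" if irr: "\<not> regular w \<epsilon> P Q" for P Q
  proof -
    obtain A B where "A \<subseteq> P" "B \<subseteq> Q"
      "\<not> \<bar>sum w (A \<times> B) - density w P Q * (card A * card B)\<bar> \<le> \<epsilon> * (card P * card Q)"
      using irr unfolding regular_def by blast
    then have "wit P Q (A, B)" by (simp add: wit_def)
    then show ?thesis unfolding C_def by (rule someI)
  qed
  define \<S>1 where "\<S>1 = (\<lambda>(P, Q). fst (C P Q)) ` (?At \<times> ?At)"
  define \<S>2 where "\<S>2 = (\<lambda>(P, Q). snd (C P Q)) ` (?At \<times> ?At)"
  define \<S>' where "\<S>' = \<S> \<union> (\<S>1 \<union> \<S>2)"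
  note at = card_atoms[OF assms(2), of V]
  have fin: "finite \<S>1" "finite \<S>2" unfolding \<S>1_def \<S>2_def using at by auto
  have "card (?At \<times> ?At) \<le> 2 ^ card \<S> * 2 ^ card \<S>"
    using at by (simp add: card_cartesian_product mult_mono)
  also have "\<dots> = 4 ^ card \<S>" by (simp flip: power_mult_distrib)
  finally have "card (f ` (?At \<times> ?At)) \<le> 4 ^ card \<S>" for f :: "'a set \<times> 'a set \<Rightarrow> 'a set"
    using card_image_le[of "?At \<times> ?At" f] at by (simp add: order_trans)
  then have "card \<S>1 \<le> 4 ^ card \<S>" "card \<S>2 \<le> 4 ^ card \<S>"
    unfolding \<S>1_def \<S>2_def by blast+
  then have card': "card \<S>' \<le> card \<S> + 2 * 4 ^ card \<S>"
    using card_Un_le[of \<S> "\<S>1 \<union> \<S>2"] card_Un_le[of \<S>1 \<S>2] unfolding \<S>'_def by linarith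
  let ?Z = "V \<times> V"
  let ?d = "avg ?Z (lab2 \<S>) w" and ?d' = "avg ?Z (lab2 \<S>') w"
  let ?I = "irregular_pairs V w \<epsilon> \<S>"
  have finZ: "finite ?Z" using assms(1) by simp
  have "\<epsilon> ^ 3 * (card V)\<^sup>2 = \<epsilon>\<^sup>2 * (\<epsilon> * (card V)\<^sup>2)" by (simp add: power2_eq_square power3_eq_cube)
  also have "\<dots> \<le> \<epsilon>\<^sup>2 * card ?I" using many by (intro mult_left_mono) auto
  also have "\<dots> = (\<Sum>z\<in>?Z. if z \<in> ?I then \<epsilon>\<^sup>2 else 0)"
    using finZ by (subst sum.inter_restrict[symmetric])
      (auto simp: irregular_pairs_def intro!: arg_cong[where f = card])
  \<comment> \<open>The sums are split into the fibres of \<open>lab2 \<S>\<close>, which are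
    products of two atoms; on each of them irregularity is all or nothing.\<close>
  also have "\<dots> \<le> (\<Sum>z\<in>?Z. (?d' z - ?d z)\<^sup>2)"
    unfolding sum.image_gen[OF finZ, of "\<lambda>z. if z \<in> ?I then \<epsilon>\<^sup>2 else 0" "lab2 \<S>"]
      sum.image_gen[OF finZ, of "\<lambda>z. (?d' z - ?d z)\<^sup>2" "lab2 \<S>"]
  proof (rule sum_mono)
    fix l assume "l \<in> lab2 \<S> ` ?Z"
    then obtain x y where xy: "x \<in> V" "y \<in> V" "l = lab2 \<S> (x, y)" by auto
    define P Q where "P = atom V \<S> x" and "Q = atom V \<S> y"
    have fibre: "{z\<in>?Z. lab2 \<S> z = l} = P \<times> Q" unfolding xy fibre_lab2 P_def Q_def ..
    have I: "z \<in> ?I \<longleftrightarrow> \<not> regular w \<epsilon> P Q" if z: "z \<in> P \<times> Q" for z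
    proof -
      have "atom V \<S> (fst z) = P" "atom V \<S> (snd z) = Q"
        using z by (auto simp: P_def Q_def atom_eq)
      moreover have "z \<in> V \<times> V" using z by (auto simp: P_def Q_def atom_def)
      ultimately show ?thesis by (simp add: irregular_pairs_def)
    qed
    show "(\<Sum>z\<in>{z\<in>?Z. lab2 \<S> z = l}. if z \<in> ?I then \<epsilon>\<^sup>2 else 0)
      \<le> (\<Sum>z\<in>{z\<in>?Z. lab2 \<S> z = l}. (?d' z - ?d z)\<^sup>2)"
    proof (cases "regular w \<epsilon> P Q")
      case True
      then have "(\<Sum>z\<in>P \<times> Q. if z \<in> ?I then \<epsilon>\<^sup>2 else 0) = 0"
        using I by (intro sum.neutral) auto
      then show ?thesis unfolding fibre by (simp add: sum_nonneg)
    next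
      case False
      have "(\<Sum>z\<in>P \<times> Q. if z \<in> ?I then \<epsilon>\<^sup>2 else 0) = (\<Sum>z\<in>P \<times> Q. \<epsilon>\<^sup>2)"
        using I False by (intro sum.cong) auto
      also have "\<dots> = \<epsilon>\<^sup>2 * (card P * card Q)" by (simp add: card_cartesian_product)
      also have "\<dots> \<le> (\<Sum>z\<in>P \<times> Q. (?d' z - ?d z)\<^sup>2)"
      proof (rule irregular_pair_gain[OF assms(1) _ _ _ _ P_def Q_def xy(1,2) _ assms(3)])
        show "fst (C P Q) \<in> \<S>'" "snd (C P Q) \<in> \<S>'"
          unfolding \<S>'_def \<S>1_def \<S>2_def P_def Q_def using xy by force+
      qed (use C[OF False] in \<open>auto simp: wit_def\<close>)
      finally show ?thesis unfolding fibre .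
    qed
  qed
  also have "\<dots> = energy V w \<S>' - energy V w \<S>"
    unfolding energy_def
  \<comment> \<open>Intersecting with \<open>\<S>\<close> forgets the new sets and recovers the old
    label.\<close>
  proof (rule avg_pythagoras[OF finZ, where r = "\<lambda>l. (fst l \<inter> \<S>, snd l \<inter> \<S>)"])
    fix z show "lab2 \<S> z = (fst (lab2 \<S>' z) \<inter> \<S>, snd (lab2 \<S>' z) \<inter> \<S>)"
      by (auto simp: lab2_def lab_def \<S>'_def)
  qed
  finally show ?thesis using that[of \<S>'] card' fin assms(2) by (simp add: \<S>'_def)
qed

text \<open>Energy grows by a fixed share of its maximum as long as the family is bad, so the number
  of refinements, and with it \<open>M\<close>, depends on \<open>\<epsilon>\<close> only.\<close>

lemma regularity_lemma:
  fixes \<epsilon> :: real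
  assumes "\<epsilon> > 0"
  obtains M :: nat where "\<And>(V :: 'v set) (w :: _ \<Rightarrow> real). finite V \<Longrightarrow> (\<And>z. z \<in> V \<times> V \<Longrightarrow> 0 \<le> w z \<and> w z \<le> 1) \<Longrightarrow>
    \<exists>\<S>. finite \<S> \<and> card \<S> \<le> M \<and> card (irregular_pairs V w \<epsilon> \<S>) \<le> \<epsilon> * (card V)\<^sup>2"
proof -
  \<comment> \<open>\<open>f j\<close> bounds the family after \<open>j\<close> refinements of the
    empty one; the recursion is the bound of \<open>energy_increment\<close>.\<close>
  define f where "f = rec_nat 0 (\<lambda>_ s. s + 2 * 4 ^ s :: nat)"
  have f: "f 0 = 0" "f (Suc j) = f j + 2 * 4 ^ f j" for j by (simp_all add: f_def)
  have f_mono: "f j \<le> f (Suc j)" for j by (simp add: f)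
  \<comment> \<open>Just large enough that \<open>k\<close> increments would exceed the maximal
    energy.\<close>
  define k where "k = nat \<lceil>1 / \<epsilon> ^ 3\<rceil> + 1"
  have k: "real k * \<epsilon> ^ 3 > 1"
  proof -
    have "1 / \<epsilon> ^ 3 < real k" unfolding k_def by linarith
    then show ?thesis using assms by (simp add: field_simps)
  qed
  show ?thesis
  proof (rule that[of "f k"])
    fix V :: "'v set" and w :: "'v \<times> 'v \<Rightarrow> real"
    assume V: "finite V" and w: "\<And>z. z \<in> V \<times> V \<Longrightarrow> 0 \<le> w z \<and> w z \<le> 1"
    define good where "good \<S> \<longleftrightarrow> card (irregular_pairs V w \<epsilon> \<S>) \<le> \<epsilon> * (card V)\<^sup>2" for \<S>
    \<comment> \<open>A good family, once found, is carried along unchanged; otherwise every stage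
      has gained its increment.\<close>
    have "\<exists>\<S>. finite \<S> \<and> card \<S> \<le> f j \<and> (good \<S> \<or> energy V w \<S> \<ge> real j * (\<epsilon> ^ 3 * (card V)\<^sup>2))" for j
    proof (induction j)
      case 0
      show ?case by (rule exI[of _ "{}"]) (auto simp: energy_def f intro: sum_nonneg)
    next
      case (Suc j)
      then obtain \<S> where S: "finite \<S>" "card \<S> \<le> f j"
        "good \<S> \<or> energy V w \<S> \<ge> real j * (\<epsilon> ^ 3 * (card V)\<^sup>2)" by blast
      show ?case
      proof (cases "good \<S>")
        case True
        then show ?thesis using S f_mono[of j] le_trans by blast
      next
        case False
        then have "card (irregular_pairs V w \<epsilon> \<S>) > \<epsilon> * (card V)\<^sup>2" by (simp add: good_def)
        from energy_increment[OF V S(1) assms this] obtain \<S>' where S':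
          "finite \<S>'" "card \<S>' \<le> card \<S> + 2 * 4 ^ card \<S>"
          "energy V w \<S>' \<ge> energy V w \<S> + \<epsilon> ^ 3 * (card V)\<^sup>2" by blast
        have "(4::nat) ^ card \<S> \<le> 4 ^ f j" using S(2) by (simp add: power_increasing)
        then have "card \<S>' \<le> f (Suc j)" using S' S(2) unfolding f by linarith
        moreover have "energy V w \<S>' \<ge> real (Suc j) * (\<epsilon> ^ 3 * (card V)\<^sup>2)"
          using S(3) S'(3) False by (simp add: algebra_simps)
        ultimately show ?thesis using S'(1) by blast
      qed
    qed
    then obtain \<S> where S: "finite \<S>" "card \<S> \<le> f k"
      "good \<S> \<or> energy V w \<S> \<ge> real k * (\<epsilon> ^ 3 * (card V)\<^sup>2)" by blast
    have "good \<S>"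
    proof (rule ccontr)
      assume bad: "\<not> good \<S>"
      \<comment> \<open>For empty \<open>V\<close> both sides of the energy bound vanish and there
        would be no contradiction.\<close>
      then have "V \<noteq> {}" by (auto simp: good_def irregular_pairs_def)
      then have pos: "real ((card V)\<^sup>2) > 0" using V by (simp add: card_gt_0_iff)
      have "energy V w \<S> \<le> (\<Sum>z\<in>V \<times> V. 1)"
        unfolding energy_def using avg_bounds[of "V \<times> V" w] w by (intro sum_mono power_le_one) auto
      also have "\<dots> = (card V)\<^sup>2" by (simp add: card_cartesian_product power2_eq_square)
      finally have "(real k * \<epsilon> ^ 3) * (card V)\<^sup>2 \<le> (card V)\<^sup>2" using S(3) bad by (simp add: mult.assoc)
      with k pos show False by (simp add: mult_le_cancel_right1)
    qed
    then show "\<exists>\<S>. finite \<S> \<and> card \<S> \<le> f k \<and> card (irregular_pairs V w \<epsilon> \<S>) \<le> \<epsilon> * (card V)\<^sup>2"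
      using S good_def by blast
  qed
qed

section \<open>Counting homomorphisms\<close>

lemma PiE_insert_sum:
  assumes "g \<notin> S"
  shows "(\<Sum>x\<in>PiE (insert g S) W. f x) = (\<Sum>y\<in>PiE S W. \<Sum>s\<in>W g. f (y(g := s)))"
proof -
  have "(\<Sum>x\<in>PiE (insert g S) W. f x) = (\<Sum>(s, y)\<in>W g \<times> PiE S W. f (y(g := s)))"
    unfolding PiE_insert_eq
    by (subst sum.reindex[OF inj_combinator[OF assms]]) (simp add: case_prod_unfold)
  also have "\<dots> = (\<Sum>s\<in>W g. \<Sum>y\<in>PiE S W. f (y(g := s)))" by (simp add: sum.cartesian_product)
  finally show ?thesis by (subst sum.swap)
qed

text \<open>The sets \<open>W g\<close> may coincide or overlap, as they do when the homomorphism to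
  \<open>F\<close> identifies vertices. \<open>D\<close> is an orientation of the edge set.\<close>

definition homs :: "'b set \<Rightarrow> ('b \<times> 'b) set \<Rightarrow> ('v \<Rightarrow> 'v \<Rightarrow> bool) \<Rightarrow> ('b \<Rightarrow> 'v set) \<Rightarrow> ('b \<Rightarrow> 'v) set" where
  "homs X D R W = {x\<in>PiE X W. \<forall>(g, h)\<in>D. R (x g) (x h)}"

text \<open>An edge constraint may be replaced by its density. Regularity is applied once for each
  choice of the other images, at a cost of \<open>\<epsilon>\<close> times the number of pairs for
  \<open>g\<close> and \<open>h\<close>; summed up, this is \<open>\<epsilon>\<close> times the
  number of all maps.\<close>

lemma homs_insert_edge:
  fixes R :: "'v \<Rightarrow> 'v \<Rightarrow> bool"
  defines "w \<equiv> \<lambda>z. of_bool (R (fst z) (snd z))"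
  assumes X: "finite X" "\<And>v. v \<in> X \<Longrightarrow> finite (W v)" "g \<in> X" "h \<in> X" "g \<noteq> h"
    and D: "(g, h) \<notin> D" "(h, g) \<notin> D" "\<And>v. (v, v) \<notin> D"
    and reg: "regular w \<epsilon> (W g) (W h)"
  shows "\<bar>real (card (homs X (insert (g, h) D) R W)) - density w (W g) (W h) * card (homs X D R W)\<bar>
    \<le> \<epsilon> * (\<Prod>v\<in>X. card (W v))"
proof -
  let ?d = "density w (W g) (W h)"
  define S where "S = X - {g, h}"
  have S: "X = insert g (insert h S)" "g \<notin> insert h S" "h \<notin> S" "finite S" using X by (auto simp: S_def)
  define p where "p x \<longleftrightarrow> (\<forall>e\<in>D. R (x (fst e)) (x (snd e)))" for x
  have finP: "finite (PiE X W)" using X by (auto intro: finite_PiE)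
  have card_filter: "real (card {x\<in>PiE X W. P x}) = (\<Sum>x\<in>PiE X W. of_bool (P x))" for P
    using finP by (simp add: of_bool_def flip: sum.inter_filter)
  have homs: "homs X D R W = {x\<in>PiE X W. p x}"
    "homs X (insert (g, h) D) R W = {x\<in>PiE X W. p x \<and> R (x g) (x h)}"
    by (auto simp: homs_def p_def)
  have "real (card (homs X (insert (g, h) D) R W)) - ?d * card (homs X D R W)
     = (\<Sum>x\<in>PiE X W. if p x then w (x g, x h) - ?d else 0)"
    unfolding homs card_filter sum_distrib_left sum_subtractf[symmetric]
    by (rule sum.cong) (auto simp: w_def)
  also have "\<dots> = (\<Sum>y\<in>PiE S W. \<Sum>t\<in>W h. \<Sum>s\<in>W g.
      if p (y(h := t, g := s)) then w (s, t) - ?d else 0)"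
    unfolding S(1) PiE_insert_sum[OF S(2)] PiE_insert_sum[OF S(3)]
    using X(5) by (intro sum.cong refl) auto
  finally have eq: "real (card (homs X (insert (g, h) D) R W)) - ?d * card (homs X D R W) = \<dots>" .
  \<comment> \<open>With all other vertices fixed, no edge of \<open>D\<close> sees both \<open>g\<close> and \<open>h\<close>, so the admissible pairs form a rectangle.\<close>
  have bound: "\<bar>\<Sum>t\<in>W h. \<Sum>s\<in>W g. if p (y(h := t, g := s)) then w (s, t) - ?d else 0\<bar>
      \<le> \<epsilon> * (card (W g) * card (W h))" for y
  proof -
    \<comment> \<open>Edges meeting neither \<open>g\<close> nor \<open>h\<close> are put into
      \<open>D1\<close>; if one of them fails for \<open>y\<close>, then \<open>A\<close> is
      empty.\<close>
    define D1 D2 where "D1 = {e\<in>D. fst e \<noteq> h \<and> snd e \<noteq> h}" and "D2 = {e\<in>D. fst e = h \<or> snd e = h}"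
    define A where "A = {s\<in>W g. \<forall>e\<in>D1. R ((y(g := s)) (fst e)) ((y(g := s)) (snd e))}"
    define B where "B = {t\<in>W h. \<forall>e\<in>D2. R ((y(h := t)) (fst e)) ((y(h := t)) (snd e))}"
    have AB: "A \<subseteq> W g" "B \<subseteq> W h" by (auto simp: A_def B_def)
    have p: "p (y(h := t, g := s)) \<longleftrightarrow> s \<in> A \<and> t \<in> B" if st: "s \<in> W g" "t \<in> W h" for s t
    proof -
      let ?x = "y(h := t, g := s)"
      have x1: "?x (fst e) = (y(g := s)) (fst e)" "?x (snd e) = (y(g := s)) (snd e)" if "e \<in> D1" for e
        using that by (auto simp: D1_def)
      have "fst e \<noteq> g" "snd e \<noteq> g" if "e \<in> D2" for e
        using that D X(5) by (cases e; auto simp: D2_def)+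
      then have x2: "?x (fst e) = (y(h := t)) (fst e)" "?x (snd e) = (y(h := t)) (snd e)" if "e \<in> D2" for e
        using that by simp_all
      have "D = D1 \<union> D2" by (auto simp: D1_def D2_def)
      then have "p ?x \<longleftrightarrow> (\<forall>e\<in>D1. R (?x (fst e)) (?x (snd e))) \<and> (\<forall>e\<in>D2. R (?x (fst e)) (?x (snd e)))"
        unfolding p_def by blast
      also have "(\<forall>e\<in>D1. R (?x (fst e)) (?x (snd e))) \<longleftrightarrow> s \<in> A"
        using st unfolding A_def by (simp only: x1 mem_Collect_eq cong: ball_cong) simp
      also have "(\<forall>e\<in>D2. R (?x (fst e)) (?x (snd e))) \<longleftrightarrow> t \<in> B"
        using st unfolding B_def by (simp only: x2 mem_Collect_eq cong: ball_cong) simp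
      finally show ?thesis .
    qed
    have fin: "finite (W g)" "finite (W h)" using X by auto
    have "(\<Sum>t\<in>W h. \<Sum>s\<in>W g. if p (y(h := t, g := s)) then w (s, t) - ?d else 0)
        = (\<Sum>s\<in>W g. \<Sum>t\<in>W h. if s \<in> A \<and> t \<in> B then w (s, t) - ?d else 0)"
      by (subst sum.swap) (simp add: p cong: sum.cong)
    also have "\<dots> = (\<Sum>z\<in>W g \<times> W h. if z \<in> A \<times> B then w z - ?d else 0)"
      unfolding sum.cartesian_product
      by (intro sum.cong refl) (simp add: split_beta mem_Times_iff cong: if_cong)
    also have "\<dots> = (\<Sum>z\<in>(W g \<times> W h) \<inter> (A \<times> B). w z - ?d)"
      using fin by (simp add: sum.inter_restrict)
    also have "(W g \<times> W h) \<inter> (A \<times> B) = A \<times> B" using AB by auto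
    also have "(\<Sum>z\<in>A \<times> B. w z - ?d) = sum w (A \<times> B) - ?d * (card A * card B)"
      by (simp add: sum_subtractf card_cartesian_product)
    finally show ?thesis using reg[unfolded regular_def, rule_format, OF AB] by (simp only:)
  qed
  have "\<bar>real (card (homs X (insert (g, h) D) R W)) - ?d * card (homs X D R W)\<bar>
      \<le> (\<Sum>y\<in>PiE S W. \<epsilon> * (card (W g) * card (W h)))"
    unfolding eq by (rule order_trans[OF sum_abs sum_mono[OF bound]])
  also have "\<dots> = \<epsilon> * (\<Prod>v\<in>X. card (W v))"
    using S by (simp add: card_PiE)
  finally show ?thesis .
qed

text \<open>Edges are inserted one by one: each multiplies the lower bound by
  \<open>\<gamma>\<close> and subtracts one further error \<open>\<epsilon>\<close>.\<close>

lemma homs_counting: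
  fixes R :: "'v \<Rightarrow> 'v \<Rightarrow> bool" and \<gamma> \<epsilon> :: real
  defines "w \<equiv> \<lambda>z. of_bool (R (fst z) (snd z))"
  assumes X: "finite X" "\<And>v. v \<in> X \<Longrightarrow> finite (W v)"
    and D: "finite D" "D \<subseteq> X \<times> X" "\<And>u v. (u, v) \<in> D \<Longrightarrow> (v, u) \<notin> D"
    and reg: "\<And>u v. (u, v) \<in> D \<Longrightarrow> regular w \<epsilon> (W u) (W v)"
    and dens: "\<And>u v. (u, v) \<in> D \<Longrightarrow> density w (W u) (W v) \<ge> \<gamma>"
    and "0 \<le> \<gamma>" "\<gamma> \<le> 1" "0 \<le> \<epsilon>"
  shows "card (homs X D R W) \<ge> (\<gamma> ^ card D - card D * \<epsilon>) * (\<Prod>v\<in>X. card (W v))"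
  using D reg dens
proof (induction D rule: finite_induct)
  case empty
  have "homs X {} R W = PiE X W" by (simp add: homs_def)
  then show ?case using X by (simp add: card_PiE)
next
  case (insert e D)
  obtain g h where e: "e = (g, h)" by force
  let ?N = "real (\<Prod>v\<in>X. card (W v))"
  have IH: "card (homs X D R W) \<ge> (\<gamma> ^ card D - card D * \<epsilon>) * ?N"
  proof (rule insert.IH)
    show "D \<subseteq> X \<times> X" using insert.prems(1) by simp
    show "(v, u) \<notin> D" if "(u, v) \<in> D" for u v using insert.prems(2)[OF insertI2[OF that]] by simp
    show "regular w \<epsilon> (W u) (W v)" if "(u, v) \<in> D" for u v using insert.prems(3)[OF insertI2[OF that]] .
    show "density w (W u) (W v) \<ge> \<gamma>" if "(u, v) \<in> D" for u v using insert.prems(4)[OF insertI2[OF that]] .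
  qed
  have e': "(g, h) \<in> insert e D" by (simp add: e)
  have irr: "(v, v) \<notin> D" for v using insert.prems(2)[of v v] by blast
  have "\<bar>real (card (homs X (insert (g, h) D) R W)) - density w (W g) (W h) * card (homs X D R W)\<bar>
    \<le> \<epsilon> * ?N"
    unfolding w_def
  proof (rule homs_insert_edge[OF X])
    show "(h, g) \<notin> D" "g \<noteq> h" using insert.prems(2)[OF e'] by (auto simp: e)
    show "g \<in> X" "h \<in> X" using insert.prems(1) by (auto simp: e)
    show "(g, h) \<notin> D" using insert.hyps e by simp
    show "regular (\<lambda>z. of_bool (R (fst z) (snd z))) \<epsilon> (W g) (W h)"
      using insert.prems(3)[OF e'] by (simp only: w_def)
  qed (assumption | fact irr)+
  then have "real (card (homs X (insert e D) R W)) \<ge> density w (W g) (W h) * card (homs X D R W) - \<epsilon> * ?N"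
    by (simp add: e)
  moreover have "density w (W g) (W h) * card (homs X D R W) \<ge> \<gamma> * card (homs X D R W)"
    using insert.prems(4)[OF e'] by (intro mult_right_mono) auto
  moreover have "\<gamma> * card (homs X D R W) \<ge> \<gamma> * ((\<gamma> ^ card D - card D * \<epsilon>) * ?N)"
    using IH \<open>0 \<le> \<gamma>\<close> by (intro mult_left_mono) auto
  \<comment> \<open>Errors of earlier edges only shrink under the factor \<open>\<gamma>\<close>, so
    they can be kept at full size.\<close>
  moreover have "\<gamma> * (card D * \<epsilon> * ?N) \<le> card D * \<epsilon> * ?N"
    using \<open>\<gamma> \<le> 1\<close> \<open>0 \<le> \<epsilon>\<close> \<open>0 \<le> \<gamma>\<close> by (intro mult_left_le_one_le mult_nonneg_nonneg) (auto simp: prod_nonneg)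
  moreover have "(\<gamma> ^ card (insert e D) - card (insert e D) * \<epsilon>) * ?N
    = \<gamma> * ((\<gamma> ^ card D - card D * \<epsilon>) * ?N) + \<gamma> * (card D * \<epsilon> * ?N) - card D * \<epsilon> * ?N - \<epsilon> * ?N"
    using insert.hyps by (simp add: field_simps)
  ultimately show ?case by linarith
qed

lemma card_few_extensions:
  assumes "finite X" "s \<in> X" "finite V"
    and few: "\<And>y. y \<in> PiE (X - {s}) (\<lambda>_. V) \<Longrightarrow> card {t\<in>V. P (y(s := t))} \<le> C"
  shows "card {x\<in>PiE X (\<lambda>_. V). P x} \<le> C * card V ^ (card X - 1)"
proof -
  define S where "S = X - {s}"
  have S: "X = insert s S" "s \<notin> S" "finite S" using assms by (auto simp: S_def)
  have fin: "finite (PiE X (\<lambda>_. V))" using assms by (auto intro: finite_PiE)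
  have "card {x\<in>PiE X (\<lambda>_. V). P x} = (\<Sum>x\<in>PiE X (\<lambda>_. V). if P x then 1 else 0)"
    using fin by (simp flip: sum.inter_filter)
  also have "\<dots> = (\<Sum>y\<in>PiE S (\<lambda>_. V). \<Sum>t\<in>V. if P (y(s := t)) then 1 else 0)"
    unfolding S(1) by (rule PiE_insert_sum[OF S(2)])
  also have "\<dots> = (\<Sum>y\<in>PiE S (\<lambda>_. V). card {t\<in>V. P (y(s := t))})"
    using assms(3) by (simp flip: sum.inter_filter)
  also have "\<dots> \<le> (\<Sum>y\<in>PiE S (\<lambda>_. V). C)"
    by (rule sum_mono) (use few in \<open>simp add: S_def\<close>)
  also have "\<dots> = C * card V ^ (card X - 1)" using S by (simp add: card_PiE)
  finally show ?thesis .
qed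

section \<open>Dense packings contain multicolor copies\<close>

lemma packing_copyE:
  assumes "packing F n k Fs" "i < k"
  obtains f where "bij_betw f (verts F) (verts (Fs i))"
    "\<And>u v. u \<in> verts F \<Longrightarrow> v \<in> verts F \<Longrightarrow> {u, v} \<in> edges F \<longleftrightarrow> {f u, f v} \<in> edges (Fs i)"
proof -
  have "isomorphic F (Fs i)" using assms by (simp add: packing_def)
  then obtain f where "bij_betw f (verts F) (verts (Fs i))"
    "\<forall>u\<in>verts F. \<forall>v\<in>verts F. {u, v} \<in> edges F \<longleftrightarrow> {f u, f v} \<in> edges (Fs i)"
    unfolding isomorphic_def by blast
  then show thesis by (intro that[of f]) auto
qed

lemma packing_verts_subset: "packing F n k Fs \<Longrightarrow> i < k \<Longrightarrow> verts (Fs i) \<subseteq> {..<n}"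
  by (simp add: packing_def subgraph_def complete_graph_def)

lemma packing_edges_subset:
  "packing F n k Fs \<Longrightarrow> i < k \<Longrightarrow> edges (Fs i) \<subseteq> {e. e \<subseteq> verts (Fs i) \<and> card e = 2}"
  by (simp add: packing_def subgraph_def simple_graph_def)

lemma packing_edges_unique:
  "packing F n k Fs \<Longrightarrow> i < k \<Longrightarrow> j < k \<Longrightarrow> e \<in> edges (Fs i) \<Longrightarrow> e \<in> edges (Fs j) \<Longrightarrow> i = j"
  unfolding packing_def by blast

text \<open>Copies that choose the same pair in \<open>B\<close> share an edge and are therefore
  equal. Used in the contrapositive, a set of fewer than \<open>k\<close> pairs misses some copy;
  with all pairs as \<open>B\<close> it yields the quadratic upper bound.\<close>

lemma packing_hit:
  assumes pack: "packing F n k Fs" and "finite B"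
    and hit: "\<And>i. i < k \<Longrightarrow> \<exists>(x, y)\<in>B. {x, y} \<in> edges (Fs i)"
  shows "k \<le> card B"
proof -
  define z where "z i = (SOME z. z \<in> B \<and> {fst z, snd z} \<in> edges (Fs i))" for i
  have z: "z i \<in> B \<and> {fst (z i), snd (z i)} \<in> edges (Fs i)" if i: "i < k" for i
  proof -
    obtain x y where "(x, y) \<in> B" "{x, y} \<in> edges (Fs i)" using hit[OF i] by blast
    then have "(x, y) \<in> B \<and> {fst (x, y), snd (x, y)} \<in> edges (Fs i)" by simp
    then show ?thesis unfolding z_def by (rule someI)
  qed
  have "inj_on z {..<k}"
  proof (rule inj_onI)
    fix i j assume ij: "i \<in> {..<k}" "j \<in> {..<k}" "z i = z j"
    then show "i = j" using z[of i] z[of j] packing_edges_unique[OF pack, of i j] by simp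
  qed
  then have "card {..<k} \<le> card B" using z \<open>finite B\<close> by (intro card_inj_on_le[of z]) auto
  then show ?thesis by simp
qed

lemma packing_le_square:
  assumes pack: "packing F n k Fs" and "simple_graph F" "edges F \<noteq> {}"
  shows "k \<le> n\<^sup>2"
proof -
  have "k \<le> card ({..<n} \<times> {..<n})"
  proof (rule packing_hit[OF pack])
    fix i assume i: "i < k"
    then have "isomorphic F (Fs i)" using pack by (simp add: packing_def)
    from isomorphic_has_edge[OF this assms(2,3)] obtain e where e: "e \<in> edges (Fs i)" by blast
    with packing_verts_subset[OF pack i] packing_edges_subset[OF pack i]
    have e': "e \<subseteq> {..<n}" "card e = 2" by auto
    then obtain x y where "e = {x, y}" by (auto simp: card_2_iff)
    then show "\<exists>(x, y)\<in>{..<n} \<times> {..<n}. {x, y} \<in> edges (Fs i)"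
      using e e' by (intro bexI[of _ "(x, y)"]) auto
  qed simp
  then show ?thesis by (simp add: card_cartesian_product power2_eq_square)
qed

text \<open>Whether the average lies below \<open>\<gamma>\<close> depends on the label alone, so
  \<open>w\<close> may be replaced by its average, which is small wherever it is counted. For
  \<open>lab2\<close> this bounds the edges in sparse pairs of parts.\<close>

lemma sum_avg_below:
  assumes "finite Z" "\<gamma> \<ge> 0"
  shows "(\<Sum>z\<in>{z\<in>Z. avg Z c w z < \<gamma>}. w z) \<le> \<gamma> * card Z"
proof -
  define h :: "_ \<Rightarrow> real" where
    "h l = of_bool ((\<Sum>u\<in>{u\<in>Z. c u = l}. w u) / card {u\<in>Z. c u = l} < \<gamma>)" for l
  have h: "h (c z) = of_bool (avg Z c w z < \<gamma>)" for z by (simp add: h_def avg_def)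
  have "(\<Sum>z\<in>{z\<in>Z. avg Z c w z < \<gamma>}. w z) = (\<Sum>z\<in>Z. if avg Z c w z < \<gamma> then w z else 0)"
    using assms(1) by (rule sum.inter_filter)
  also have "\<dots> = (\<Sum>z\<in>Z. w z * h (c z))" by (rule sum.cong) (auto simp: h)
  also have "\<dots> = (\<Sum>z\<in>Z. avg Z c w z * h (c z))" by (rule sum_avg[OF assms(1), symmetric])
  also have "\<dots> \<le> (\<Sum>z\<in>Z. \<gamma>)" by (rule sum_mono) (use assms(2) in \<open>auto simp: h\<close>)
  finally show ?thesis by (simp add: mult.commute)
qed

text \<open>There are at most \<open>2 ^ card \<S>\<close> atoms, and each small one holds fewer
  than \<open>s\<close> vertices.\<close>

lemma card_small_atoms:
  fixes s :: real
  assumes "finite V" "finite \<S>" "s \<ge> 0"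
  shows "card {x\<in>V. card (atom V \<S> x) < s} \<le> 2 ^ card \<S> * s"
proof -
  let ?U = "{P\<in>atom V \<S> ` V. card P < s}"
  note at = card_atoms[OF assms(2), of V]
  have U: "finite ?U" using at by simp
  have finP: "finite P" if "P \<in> ?U" for P using that assms(1) by (auto simp: atom_def)
  have "card {x\<in>V. card (atom V \<S> x) < s} \<le> card (\<Union>?U)"
  proof (rule card_mono)
    show "finite (\<Union>?U)" using U finP by (rule finite_Union)
    show "{x\<in>V. card (atom V \<S> x) < s} \<subseteq> \<Union>?U" using atom_self[of _ V \<S>] by blast
  qed
  also have "\<dots> \<le> sum card ?U" by (rule card_Union_le_sum_card)
  finally have "real (card {x\<in>V. card (atom V \<S> x) < s}) \<le> (\<Sum>P\<in>?U. real (card P))"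
    by (simp flip: of_nat_sum)
  also have "\<dots> \<le> (\<Sum>P\<in>?U. s)" by (rule sum_mono) auto
  also have "\<dots> = real (card ?U) * s" by simp
  also have "\<dots> \<le> 2 ^ card \<S> * s"
  proof (rule mult_right_mono[OF _ assms(3)])
    have "card ?U \<le> card (atom V \<S> ` V)" using at by (intro card_mono) auto
    then have "card ?U \<le> 2 ^ card \<S>" using at(2) by (rule le_trans)
    then have "real (card ?U) \<le> real (2 ^ card \<S>)" by (simp only: of_nat_le_iff)
    then show "real (card ?U) \<le> 2 ^ card \<S>" by simp
  qed
  finally show ?thesis .
qed

definition adj :: "nat \<Rightarrow> (nat \<Rightarrow> 'a graph) \<Rightarrow> 'a \<Rightarrow> 'a \<Rightarrow> bool" where
  "adj k Fs x y \<longleftrightarrow> (\<exists>i<k. {x, y} \<in> edges (Fs i))"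

text \<open>The irregular pairs, the sparse edges and the pairs meeting a small atom each number at
  most \<open>\<eta> / 4 * n\<^sup>2\<close>. Together they are fewer than the copies, so
  \<open>packing_hit\<close> leaves a copy that avoids them all. \<open>W x\<close> is the atom of
  \<open>x\<close>.\<close>

lemma packing_regular_copy:
  fixes \<eta> \<epsilon> \<gamma> :: real
  assumes "\<eta> > 0" "0 < \<epsilon>" "\<epsilon> \<le> \<eta> / 4" "0 < \<gamma>" "\<gamma> \<le> \<eta> / 4"
  obtains \<sigma> :: real where "\<sigma> > 0"
    "\<And>n k Fs. n > 0 \<Longrightarrow> packing F n k Fs \<Longrightarrow> real k \<ge> \<eta> * real n ^ 2 \<Longrightarrow>
      \<exists>i<k. \<exists>W. (\<forall>x. W x \<subseteq> {..<n}) \<and> (\<forall>x y. {x, y} \<in> edges (Fs i) \<longrightarrow>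
        regular (\<lambda>z. of_bool (adj k Fs (fst z) (snd z))) \<epsilon> (W x) (W y) \<and>
        density (\<lambda>z. of_bool (adj k Fs (fst z) (snd z))) (W x) (W y) \<ge> \<gamma> \<and> card (W x) \<ge> \<sigma> * n)"
proof -
  obtain M :: nat where M: "\<And>(V :: nat set) (w :: _ \<Rightarrow> real). finite V \<Longrightarrow>
      (\<And>z. z \<in> V \<times> V \<Longrightarrow> 0 \<le> w z \<and> w z \<le> 1) \<Longrightarrow>
      \<exists>\<S>. finite \<S> \<and> card \<S> \<le> M \<and> card (irregular_pairs V w \<epsilon> \<S>) \<le> \<epsilon> * (card V)\<^sup>2"
    using regularity_lemma[OF \<open>0 < \<epsilon>\<close>, where ?'v = nat] by blast
  \<comment> \<open>At most \<open>2 ^ M\<close> atoms below \<open>\<sigma> * n\<close> cover at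
    most an \<open>\<eta> / 8\<close> share of the vertices; the second factor 2 comes from the two
    coordinates of a pair.\<close>
  define \<sigma> where "\<sigma> = \<eta> / (8 * 2 ^ M)"
  show ?thesis
  proof (rule that[of \<sigma>])
    show "\<sigma> > 0" using assms by (simp add: \<sigma>_def)
    fix n k Fs
    assume n: "n > 0" and pack: "packing F n k Fs" and k: "real k \<ge> \<eta> * real n ^ 2"
    define w where "w z = (of_bool (adj k Fs (fst z) (snd z)) :: real)" for z
    let ?V = "{..<n}"
    have "finite ?V" by simp
    moreover have "0 \<le> w z \<and> w z \<le> 1" for z by (simp add: w_def)
    ultimately obtain \<S> where S: "finite \<S>" "card \<S> \<le> M"
      "card (irregular_pairs ?V w \<epsilon> \<S>) \<le> \<epsilon> * (card ?V)\<^sup>2"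
      using M[of ?V w] by blast
    define small where "small = {x\<in>?V. card (atom ?V \<S> x) < \<sigma> * n}"
    \<comment> \<open>Only edges are collected: non-edges in sparse pairs can be numerous, but no
      copy uses them.\<close>
    define sparse where "sparse = {z\<in>?V \<times> ?V. w z = 1 \<and> avg (?V \<times> ?V) (lab2 \<S>) w z < \<gamma>}"
    define I where "I = irregular_pairs ?V w \<epsilon> \<S>"
    define B where "B = I \<union> (sparse \<union> (small \<times> ?V \<union> ?V \<times> small))"
    have fin: "finite I" "finite sparse" "finite small"
      unfolding I_def sparse_def small_def irregular_pairs_def
      by (auto intro: finite_subset[of _ "?V \<times> ?V"])
    have "card small \<le> 2 ^ card \<S> * (\<sigma> * n)"
      unfolding small_def using \<open>\<sigma> > 0\<close> S(1) by (intro card_small_atoms) auto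
    also have "\<dots> \<le> 2 ^ M * (\<sigma> * n)"
      using S(2) \<open>\<sigma> > 0\<close> by (intro mult_right_mono power_increasing) auto
    also have "\<dots> = \<eta> / 8 * n" by (simp add: \<sigma>_def)
    finally have small: "card small \<le> \<eta> / 8 * n" .
    have "real (card sparse) = (\<Sum>z\<in>sparse. w z)" by (simp add: sparse_def)
    also have "\<dots> \<le> (\<Sum>z\<in>{z\<in>?V \<times> ?V. avg (?V \<times> ?V) (lab2 \<S>) w z < \<gamma>}. w z)"
      by (rule sum_mono2) (auto simp: sparse_def w_def)
    also have "\<dots> \<le> \<gamma> * card (?V \<times> ?V)" using assms by (intro sum_avg_below) auto
    finally have sparse: "card sparse \<le> \<gamma> * real n ^ 2"
      by (simp add: card_cartesian_product power2_eq_square)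
    have "card B \<le> card I + (card sparse + (card small * n + n * card small))"
      unfolding B_def
      using card_Un_le[of I "sparse \<union> (small \<times> ?V \<union> ?V \<times> small)"]
        card_Un_le[of sparse "small \<times> ?V \<union> ?V \<times> small"] card_Un_le[of "small \<times> ?V" "?V \<times> small"]
      by (simp add: card_cartesian_product)
    then have "real (card B) \<le> card I + card sparse + 2 * (card small * real n)"
      unfolding of_nat_le_iff[where ?'a = real, symmetric] by (simp add: algebra_simps)
    moreover have "card small * real n \<le> \<eta> / 8 * real n ^ 2"
      using mult_right_mono[OF small, of "real n"] by (simp add: power2_eq_square)
    moreover have "real (card I) \<le> \<eta> / 4 * real n ^ 2"
      using S(3) mult_right_mono[OF assms(3), of "real n ^ 2"] by (simp add: I_def)
    moreover have "real (card sparse) \<le> \<eta> / 4 * real n ^ 2"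
      using sparse mult_right_mono[OF assms(5), of "real n ^ 2"] by simp
    ultimately have "real (card B) \<le> 3 / 4 * (\<eta> * real n ^ 2)" by simp
    moreover have "\<eta> * real n ^ 2 > 0" using n assms(1) by simp
    ultimately have "card B < k" using k by linarith
    have "finite B" using fin by (simp add: B_def)
    obtain i where i: "i < k" and miss: "\<And>x y. (x, y) \<in> B \<Longrightarrow> {x, y} \<notin> edges (Fs i)"
    proof -
      have "\<not> (\<forall>i<k. \<exists>(x, y)\<in>B. {x, y} \<in> edges (Fs i))"
        using packing_hit[OF pack \<open>finite B\<close>] \<open>card B < k\<close> by (meson leD)
      then show thesis using that by blast
    qed
    have good: "regular w \<epsilon> (atom ?V \<S> x) (atom ?V \<S> y) \<and>
        density w (atom ?V \<S> x) (atom ?V \<S> y) \<ge> \<gamma> \<and> card (atom ?V \<S> x) \<ge> \<sigma> * n"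
      if e: "{x, y} \<in> edges (Fs i)" for x y
    proof -
      have V: "x \<in> ?V" "y \<in> ?V"
        using packing_verts_subset[OF pack i] packing_edges_subset[OF pack i] e by auto
      have "w (x, y) = 1" using e i by (auto simp: w_def adj_def)
      moreover have "(x, y) \<notin> B" using e miss by blast
      ultimately show ?thesis using V
        by (auto simp: B_def I_def sparse_def small_def irregular_pairs_def not_less avg_lab2)
    qed
    show "\<exists>i<k. \<exists>W. (\<forall>x. W x \<subseteq> {..<n}) \<and> (\<forall>x y. {x, y} \<in> edges (Fs i) \<longrightarrow>
        regular (\<lambda>z. of_bool (adj k Fs (fst z) (snd z))) \<epsilon> (W x) (W y) \<and>
        density (\<lambda>z. of_bool (adj k Fs (fst z) (snd z))) (W x) (W y) \<ge> \<gamma> \<and> card (W x) \<ge> \<sigma> * n)"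
    proof (intro exI conjI)
      show "i < k" by fact
      show "\<forall>x. atom ?V \<S> x \<subseteq> {..<n}" by (auto simp: atom_def)
      show "\<forall>x y. {x, y} \<in> edges (Fs i) \<longrightarrow>
        regular (\<lambda>z. of_bool (adj k Fs (fst z) (snd z))) \<epsilon> (atom ?V \<S> x) (atom ?V \<S> y) \<and>
        density (\<lambda>z. of_bool (adj k Fs (fst z) (snd z))) (atom ?V \<S> x) (atom ?V \<S> y) \<ge> \<gamma> \<and>
        card (atom ?V \<S> x) \<ge> \<sigma> * n"
        using good unfolding w_def[abs_def] by blast
    qed
  qed
qed

text \<open>\<open>homs_counting\<close> inserts every edge once; with both orientations present, an
  edge of \<open>D\<close> could join the two ends of the inserted edge.\<close>

lemma orient_edges:
  assumes "simple_graph G"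
  obtains D where "D \<subseteq> verts G \<times> verts G" "finite D" "\<And>u v. (u, v) \<in> D \<Longrightarrow> (v, u) \<notin> D"
    "edges G = (\<lambda>(u, v). {u, v}) ` D"
proof -
  have "\<exists>z. e = {fst z, snd z} \<and> fst z \<noteq> snd z" if "e \<in> edges G" for e
  proof -
    have "card e = 2" using assms that by (auto simp: simple_graph_def)
    then obtain u v where "e = {u, v}" "u \<noteq> v" by (auto simp: card_2_iff)
    then show ?thesis by (intro exI[of _ "(u, v)"]) simp
  qed
  then obtain z where z: "\<And>e. e \<in> edges G \<Longrightarrow> e = {fst (z e), snd (z e)} \<and> fst (z e) \<noteq> snd (z e)"
    by metis
  define D where "D = z ` edges G"
  have sub: "D \<subseteq> verts G \<times> verts G"
  proof
    fix p assume "p \<in> D"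
    then obtain e where e: "e \<in> edges G" "p = z e" by (auto simp: D_def)
    then have "e \<subseteq> verts G" using assms by (auto simp: simple_graph_def)
    with z[OF e(1)] e(2) show "p \<in> verts G \<times> verts G" by (auto simp: mem_Times_iff)
  qed
  have edge: "e = {u, v} \<and> u \<noteq> v" if "e \<in> edges G" "z e = (u, v)" for e u v
    using z[OF that(1)] that(2) by simp
  show ?thesis
  proof (rule that[OF sub])
    have "finite (verts G)" using assms by (simp add: simple_graph_def)
    then show "finite D" using sub finite_subset by blast
    show "(v, u) \<notin> D" if uv: "(u, v) \<in> D" for u v
    proof
      assume "(v, u) \<in> D"
      with uv obtain e e' where e: "e \<in> edges G" "e' \<in> edges G" "z e = (u, v)" "z e' = (v, u)"
        unfolding D_def by (metis imageE)
      then have "e = {u, v}" "e' = {v, u}" "u \<noteq> v" using edge by blast+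
      then have "e = e'" by blast
      with e \<open>u \<noteq> v\<close> show False by simp
    qed
    show "edges G = (\<lambda>(u, v). {u, v}) ` D"
      unfolding D_def image_image case_prod_beta using z by (auto simp: image_iff)
  qed
qed

text \<open>Meant for \<open>s\<close> outside \<open>e\<close>. This one event covers both ways in
  which a homomorphic image can fail to be a multicolor copy.\<close>

definition touches_same_copy :: "nat \<Rightarrow> (nat \<Rightarrow> nat graph) \<Rightarrow> 'b set \<Rightarrow> 'b \<Rightarrow> ('b \<Rightarrow> nat) \<Rightarrow> bool" where
  "touches_same_copy k Fs e s x \<longleftrightarrow> (\<exists>i<k. x ` e \<in> edges (Fs i) \<and> x s \<in> verts (Fs i))"

text \<open>The images under \<open>x\<close> of the vertices outside \<open>s\<close> already determine the copy containing \<open>x ` e\<close>.\<close>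

lemma card_touches_same_copy:
  assumes pack: "packing F n k Fs" and "finite (verts F)" "finite X" "s \<in> X" "s \<notin> e"
  shows "card {x\<in>PiE X (\<lambda>_. {..<n}). touches_same_copy k Fs e s x} \<le> card (verts F) * n ^ (card X - 1)"
proof -
  have "card {t\<in>{..<n}. touches_same_copy k Fs e s (y(s := t))} \<le> card (verts F)" for y
  proof (cases "\<exists>i<k. y ` e \<in> edges (Fs i)")
    case True
    then obtain i where i: "i < k" "y ` e \<in> edges (Fs i)" by blast
    obtain f where f: "bij_betw f (verts F) (verts (Fs i))" using packing_copyE[OF pack i(1)] .
    have img: "y(s := t) ` e = y ` e" for t using \<open>s \<notin> e\<close> by auto
    have sub: "{t\<in>{..<n}. touches_same_copy k Fs e s (y(s := t))} \<subseteq> verts (Fs i)"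
    proof
      fix t assume "t \<in> {t\<in>{..<n}. touches_same_copy k Fs e s (y(s := t))}"
      then obtain j where j: "j < k" "y ` e \<in> edges (Fs j)" "t \<in> verts (Fs j)"
        unfolding touches_same_copy_def img by auto
      then have "j = i" using packing_edges_unique[OF pack _ i(1) _ i(2)] by blast
      with j show "t \<in> verts (Fs i)" by simp
    qed
    have "finite (verts (Fs i))" using f assms(2) by (simp add: bij_betw_finite)
    then have "card {t\<in>{..<n}. touches_same_copy k Fs e s (y(s := t))} \<le> card (verts (Fs i))"
      using sub by (rule card_mono)
    also have "\<dots> = card (verts F)" using bij_betw_same_card[OF f] by simp
    finally show ?thesis .
  next
    case False
    have img: "y(s := t) ` e = y ` e" for t using \<open>s \<notin> e\<close> by auto
    have "{t\<in>{..<n}. touches_same_copy k Fs e s (y(s := t))} = {}"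
      unfolding touches_same_copy_def img using False by blast
    then show ?thesis by (simp only: card.empty)
  qed
  then have "card {x\<in>PiE X (\<lambda>_. {..<n}). touches_same_copy k Fs e s x}
      \<le> card (verts F) * card {..<n} ^ (card X - 1)"
    by (intro card_few_extensions[OF assms(3,4)]) auto
  then show ?thesis by simp
qed

text \<open>If \<open>x\<close> identifies \<open>g\<close> and \<open>h\<close>, take an edge
  \<open>e\<close> at \<open>h\<close>: either \<open>g\<close> is its other end and the image is no
  edge, or \<open>x g\<close> lies in the copy containing the image of \<open>e\<close>. If two
  edges go to the same copy, a vertex of one outside the other is mapped into that copy.
  \<open>free\<close> excludes these cases.\<close>

lemma multicolor_copyI:
  fixes G :: "'b graph"
  assumes pack: "packing F n k Fs" and G: "simple_graph G" "\<nexists>v. isolated v G"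
    and edge: "\<And>e. e \<in> edges G \<Longrightarrow> \<exists>i<k. x ` e \<in> edges (Fs i)"
    and free: "\<And>e s. e \<in> edges G \<Longrightarrow> s \<in> verts G \<Longrightarrow> s \<notin> e \<Longrightarrow> \<not> touches_same_copy k Fs e s x"
  shows "has_multicolor_copy k Fs G"
proof -
  have G_edge: "e \<subseteq> verts G" "card e = 2" "finite e" if "e \<in> edges G" for e
    using G(1) that by (auto simp: simple_graph_def intro: finite_subset)
  have Fs_edge: "e \<subseteq> verts (Fs i)" "card e = 2" if ie: "i < k" "e \<in> edges (Fs i)" for e i
    using packing_edges_subset[OF pack ie(1)] ie(2) by auto
  have covered: "\<exists>e\<in>edges G. v \<in> e" if "v \<in> verts G" for v
    using G(2) that by (auto simp: isolated_def)
  have inj: "inj_on x (verts G)"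
  proof (rule inj_onI, rule ccontr)
    fix g h assume gh: "g \<in> verts G" "h \<in> verts G" "x g = x h" "g \<noteq> h"
    obtain e where e: "e \<in> edges G" "h \<in> e" using covered gh by blast
    obtain i where i: "i < k" "x ` e \<in> edges (Fs i)" using edge[OF e(1)] by blast
    show False
    proof (cases "g \<in> e")
      case True
      have "card (e - {g}) = 1" using G_edge[OF e(1)] True by simp
      moreover have "x ` e = x ` (e - {g})" using gh e(2) True by auto
      ultimately have "card (x ` e) \<le> 1"
        using G_edge[OF e(1)] card_image_le[of "e - {g}" x] by simp
      then show False using Fs_edge(2)[OF i] by simp
    next
      case False
      have "x g \<in> verts (Fs i)" using Fs_edge(1)[OF i] e(2) gh(3) by auto
      then have "touches_same_copy k Fs e g x" using i by (auto simp: touches_same_copy_def)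
      then show False using free[OF e(1) gh(1) False] by simp
    qed
  qed
  define G' where "G' = Graph (x ` verts G) ((`) x ` edges G)"
  have "subgraph G' (graph_Union k Fs)"
    unfolding subgraph_def simple_graph_def
  proof (intro conjI)
    show "finite (verts G')" using G(1) by (simp add: G'_def simple_graph_def)
    show "edges G' \<subseteq> {e. e \<subseteq> verts G' \<and> card e = 2}"
    proof
      fix e assume "e \<in> edges G'"
      then obtain e0 where e0: "e0 \<in> edges G" "e = x ` e0" by (auto simp: G'_def)
      obtain i where "i < k" "x ` e0 \<in> edges (Fs i)" using edge[OF e0(1)] by blast
      then show "e \<in> {e. e \<subseteq> verts G' \<and> card e = 2}"
        using Fs_edge(2) e0 G_edge(1)[OF e0(1)] by (auto simp: G'_def)
    qed
    show "verts G' \<subseteq> verts (graph_Union k Fs)"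
    proof
      fix a assume "a \<in> verts G'"
      then obtain v where v: "v \<in> verts G" "a = x v" by (auto simp: G'_def)
      obtain e where e: "e \<in> edges G" "v \<in> e" using covered v by blast
      obtain i where i: "i < k" "x ` e \<in> edges (Fs i)" using edge[OF e(1)] by blast
      then have "a \<in> verts (Fs i)" using Fs_edge(1)[OF i] e v by auto
      then show "a \<in> verts (graph_Union k Fs)" using i by (auto simp: graph_Union_def)
    qed
    show "edges G' \<subseteq> edges (graph_Union k Fs)"
      using edge by (auto simp: G'_def graph_Union_def)
  qed
  moreover have "isomorphic G G'"
    unfolding isomorphic_def
  proof (intro exI conjI ballI)
    show "bij_betw x (verts G) (verts G')" using inj by (simp add: G'_def bij_betw_def)
    fix u v assume uv: "u \<in> verts G" "v \<in> verts G"
    have "{u, v} \<in> edges G" if xuv: "{x u, x v} \<in> edges G'"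
    proof -
      obtain e where e: "e \<in> edges G" "{x u, x v} = x ` e" using xuv by (auto simp: G'_def)
      then have "x ` {u, v} = x ` e" by simp
      then have "{u, v} = e"
        using inj_on_image_eq_iff[OF inj, of "{u, v}" e] uv G_edge(1)[OF e(1)] by simp
      then show ?thesis using e by simp
    qed
    moreover have "{x u, x v} \<in> edges G'" if "{u, v} \<in> edges G"
      using imageI[OF that, of "(`) x"] by (simp add: G'_def)
    ultimately show "{u, v} \<in> edges G \<longleftrightarrow> {x u, x v} \<in> edges G'" by blast
  qed
  moreover have "card (edges G' \<inter> edges (Fs i)) \<le> 1" if i: "i < k" for i
  proof -
    have "a = b" if ab: "a \<in> edges G' \<inter> edges (Fs i)" "b \<in> edges G' \<inter> edges (Fs i)" for a b
    proof (rule ccontr)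
      assume "a \<noteq> b"
      obtain e e' where e: "e \<in> edges G" "a = x ` e" "e' \<in> edges G" "b = x ` e'"
        using ab by (auto simp: G'_def)
      have "e \<noteq> e'" using \<open>a \<noteq> b\<close> e by auto
      then have "\<not> e' \<subseteq> e"
        using card_subset_eq[of e e'] G_edge[OF e(1)] G_edge[OF e(3)] by auto
      then obtain s where s: "s \<in> e'" "s \<notin> e" by blast
      have "x s \<in> verts (Fs i)" using Fs_edge(1)[OF i, of b] ab e s by auto
      then have "touches_same_copy k Fs e s x"
        using i ab e by (auto simp: touches_same_copy_def)
      then show False using free[OF e(1) _ s(2)] G_edge(1)[OF e(3)] s by blast
    qed
    moreover have "finite (edges G' \<inter> edges (Fs i))"
    proof -
      have "finite (edges G)"
        using G(1) finite_subset[of "edges G" "Pow (verts G)"] by (auto simp: simple_graph_def)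
      then show ?thesis by (simp add: G'_def)
    qed
    ultimately show ?thesis by (simp add: card_le_Suc0_iff_eq)
  qed
  ultimately show ?thesis unfolding has_multicolor_copy_def by blast
qed

text \<open>A packing that is too large gives order \<open>n ^ card X\<close> homomorphic images of
  \<open>G\<close>, one power of \<open>n\<close> more than there are maps to exclude.\<close>

lemma no_multicolor_copy_small:
  fixes F :: "'a graph" and G :: "'b graph" and \<eta> :: real
  assumes F: "simple_graph F" and G: "simple_graph G" "verts G \<noteq> {}" "\<nexists>v. isolated v G"
    and hom: "graph_hom \<phi> G F" and "\<eta> > 0"
  shows "\<exists>N. \<forall>n\<ge>N. \<forall>k Fs. packing F n k Fs \<and> \<not> has_multicolor_copy k Fs G \<longrightarrow> real k < \<eta> * real n ^ 2"
proof -
  define X where "X = verts G"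
  have X: "finite X" "X \<noteq> {}" using G by (auto simp: X_def simple_graph_def)
  have finE: "finite (edges G)"
    using G(1) finite_subset[of "edges G" "Pow (verts G)"] by (auto simp: simple_graph_def)
  obtain D where D: "D \<subseteq> X \<times> X" "finite D" "\<And>u v. (u, v) \<in> D \<Longrightarrow> (v, u) \<notin> D"
    "edges G = (\<lambda>(u, v). {u, v}) ` D"
    using orient_edges[OF G(1)] unfolding X_def by blast
  define m where "m = card D"
  define \<gamma> where "\<gamma> = min (\<eta> / 4) 1"
  \<comment> \<open>The second term keeps the total error \<open>m * \<epsilon>\<close> below half
    of the main term \<open>\<gamma> ^ m\<close>; adding 1 keeps the denominator positive for every
    \<open>m\<close>.\<close>
  define \<epsilon> where "\<epsilon> = min (\<eta> / 4) (\<gamma> ^ m / (2 * (real m + 1)))"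
  have \<gamma>: "0 < \<gamma>" "\<gamma> \<le> \<eta> / 4" "\<gamma> \<le> 1" using \<open>\<eta> > 0\<close> by (auto simp: \<gamma>_def)
  have \<epsilon>: "0 < \<epsilon>" "\<epsilon> \<le> \<eta> / 4"
    unfolding \<epsilon>_def by (use \<open>\<eta> > 0\<close> \<gamma>(1) in \<open>simp add: field_simps add_pos_pos\<close>) (rule min.cobounded1)
  have "m * \<epsilon> \<le> real m * (\<gamma> ^ m / (2 * (real m + 1)))"
    by (rule mult_left_mono) (auto simp: \<epsilon>_def)
  also have "\<dots> \<le> \<gamma> ^ m / 2" using \<gamma>(1) by (simp add: field_simps)
  finally have half: "\<gamma> ^ m / 2 \<le> \<gamma> ^ m - m * \<epsilon>" by (simp add: field_simps)
  obtain \<sigma> :: real where "\<sigma> > 0" and copy: "\<And>n k Fs. n > 0 \<Longrightarrow> packing F n k Fs \<Longrightarrow> real k \<ge> \<eta> * real n ^ 2 \<Longrightarrow>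
      \<exists>i<k. \<exists>W. (\<forall>x. W x \<subseteq> {..<n}) \<and> (\<forall>x y. {x, y} \<in> edges (Fs i) \<longrightarrow>
        regular (\<lambda>z. of_bool (adj k Fs (fst z) (snd z))) \<epsilon> (W x) (W y) \<and>
        density (\<lambda>z. of_bool (adj k Fs (fst z) (snd z))) (W x) (W y) \<ge> \<gamma> \<and> card (W x) \<ge> \<sigma> * n)"
    using packing_regular_copy[OF \<open>\<eta> > 0\<close> \<epsilon> \<gamma>(1,2), of F] by blast
  define q where "q = card X - 1"
  have q: "card X = Suc q" using X by (simp add: q_def card_gt_0_iff)
  define c where "c = \<gamma> ^ m / 2 * \<sigma> ^ card X"
  have "c > 0" using \<gamma> \<open>\<sigma> > 0\<close> by (simp add: c_def)
  \<comment> \<open>One term for each edge \<open>e\<close> and vertex \<open>s\<close>, and one for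
    each vertex of the copy that \<open>x s\<close> might hit.\<close>
  define K where "K = card (edges G) * card X * card (verts F)"
  define N where "N = nat \<lceil>K / c\<rceil> + 1"
  show ?thesis
  proof (intro exI[of _ N] allI impI)
    fix n k Fs
    assume "N \<le> n" and "packing F n k Fs \<and> \<not> has_multicolor_copy k Fs G"
    then have pack: "packing F n k Fs" and none: "\<not> has_multicolor_copy k Fs G" by auto
    have n: "n > 0" "K / c < n" using \<open>N \<le> n\<close> unfolding N_def by linarith+
    show "real k < \<eta> * real n ^ 2"
    proof (rule ccontr)
      assume "\<not> real k < \<eta> * real n ^ 2"
      then have k: "real k \<ge> \<eta> * real n ^ 2" by simp
      define w where "w z = (of_bool (adj k Fs (fst z) (snd z)) :: real)" for z
      obtain i W where i: "i < k" and W: "\<And>x. W x \<subseteq> {..<n}"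
        and good: "\<And>x y. {x, y} \<in> edges (Fs i) \<Longrightarrow> regular w \<epsilon> (W x) (W y) \<and>
          density w (W x) (W y) \<ge> \<gamma> \<and> card (W x) \<ge> \<sigma> * n"
        using copy[OF n(1) pack k] unfolding w_def by blast
      have "isomorphic F (Fs i)" using pack i by (simp add: packing_def)
      then obtain f where f: "\<forall>u\<in>verts F. \<forall>v\<in>verts F. {u, v} \<in> edges F \<longleftrightarrow> {f u, f v} \<in> edges (Fs i)"
        unfolding isomorphic_def by blast
      have image_edge: "{f (\<phi> u), f (\<phi> v)} \<in> edges (Fs i)" if "{u, v} \<in> edges G" for u v
      proof -
        have "{\<phi> u, \<phi> v} \<in> edges F" using hom that by (simp add: graph_hom_def)
        moreover have "{\<phi> u, \<phi> v} \<subseteq> verts F" using F calculation by (auto simp: simple_graph_def)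
        ultimately show ?thesis using f by simp
      qed
      define U where "U g = W (f (\<phi> g))" for g
      have U_sub: "U g \<subseteq> {..<n}" for g using W by (simp add: U_def)
      have finU: "finite (U g)" for g using U_sub finite_subset by blast
      have U_edge: "regular w \<epsilon> (U u) (U v)" "density w (U u) (U v) \<ge> \<gamma>" "card (U u) \<ge> \<sigma> * n"
        if "{u, v} \<in> edges G" for u v
        using good[OF image_edge[OF that]] by (auto simp: U_def)
      have D_edge: "{u, v} \<in> edges G" if "(u, v) \<in> D" for u v using that D(4) by force
      \<comment> \<open>The size bound is known only at ends of edges of the copy; every vertex of
        \<open>G\<close> lies on an edge, so it holds throughout \<open>X\<close>.\<close>
      have U_big: "card (U g) \<ge> \<sigma> * n" if g: "g \<in> X" for g
      proof -
        obtain e where e: "e \<in> edges G" "g \<in> e" using G(3) g by (auto simp: isolated_def X_def)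
        have "card e = 2" using G(1) e by (auto simp: simple_graph_def)
        then obtain h where "e = {g, h}" using e(2) by (auto simp: card_2_iff)
        then show ?thesis using U_edge(3) e by blast
      qed
      define H where "H = homs X D (adj k Fs) U"
      have "c * real n ^ card X = \<gamma> ^ m / 2 * (\<Prod>g\<in>X. \<sigma> * real n)"
        by (simp add: c_def power_mult_distrib)
      also have "\<dots> \<le> (\<gamma> ^ m - m * \<epsilon>) * (\<Prod>g\<in>X. card (U g))"
        unfolding of_nat_prod
      proof (intro mult_mono half prod_mono prod_nonneg)
        show "0 \<le> \<gamma> ^ m - m * \<epsilon>" using half zero_less_power[OF \<gamma>(1), of m] by linarith
      qed (use \<open>\<sigma> > 0\<close> U_big in auto)
      also have "\<dots> \<le> card H"
        unfolding H_def m_def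
      proof (rule homs_counting[OF X(1) finU D(2,1,3)])
        show "regular (\<lambda>z. of_bool (adj k Fs (fst z) (snd z))) \<epsilon> (U u) (U v)" if "(u, v) \<in> D" for u v
          using U_edge(1)[OF D_edge[OF that]] unfolding w_def .
        show "density (\<lambda>z. of_bool (adj k Fs (fst z) (snd z))) (U u) (U v) \<ge> \<gamma>" if "(u, v) \<in> D" for u v
          using U_edge(2)[OF D_edge[OF that]] unfolding w_def .
      qed (use \<gamma> \<epsilon> in auto)
      finally have many: "c * real n ^ card X \<le> card H" .
      define T where "T = {(e, s). e \<in> edges G \<and> s \<in> X \<and> s \<notin> e}"
      define bad where "bad p = {x\<in>PiE X (\<lambda>_. {..<n}). touches_same_copy k Fs (fst p) (snd p) x}" for p
      have T: "finite T" "card T \<le> card (edges G) * card X"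
      proof -
        have "T \<subseteq> edges G \<times> X" by (auto simp: T_def)
        then show "finite T" "card T \<le> card (edges G) * card X"
          using finE X(1) finite_subset[of T "edges G \<times> X"] card_mono[of "edges G \<times> X" T]
          by (auto simp: card_cartesian_product)
      qed
      have finV: "finite (verts F)" using F by (simp add: simple_graph_def)
      have "card (\<Union>p\<in>T. bad p) \<le> (\<Sum>p\<in>T. card (bad p))" by (rule card_UN_le[OF T(1)])
      also have "\<dots> \<le> (\<Sum>p\<in>T. card (verts F) * n ^ (card X - 1))"
        unfolding bad_def
        by (intro sum_mono card_touches_same_copy[OF pack finV X(1)]) (auto simp: T_def)
      also have "\<dots> \<le> K * n ^ q" using T(2) by (simp add: K_def q_def)
      finally have "real (card (\<Union>p\<in>T. bad p)) \<le> real (K * n ^ q)" by (simp only: of_nat_le_iff)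
      also have "\<dots> < c * n * real n ^ q"
        using n \<open>c > 0\<close> by (simp add: field_simps)
      also have "\<dots> = c * real n ^ card X" by (simp add: q)
      also note many
      finally have "card (\<Union>p\<in>T. bad p) < card H" by simp
      moreover have "finite (\<Union>p\<in>T. bad p)"
        using T(1) X(1) by (auto simp: bad_def intro!: finite_PiE)
      ultimately have "\<not> H \<subseteq> (\<Union>p\<in>T. bad p)" using card_mono leD by blast
      then obtain x where x: "x \<in> H" "x \<notin> (\<Union>p\<in>T. bad p)" by blast
      have xP: "x \<in> PiE X (\<lambda>_. {..<n})"
      proof -
        have "x \<in> PiE X U" using x(1) by (simp add: H_def homs_def)
        then show ?thesis using U_sub by (blast intro: PiE_mono[THEN subsetD])
      qed
      have "has_multicolor_copy k Fs G"
      proof (rule multicolor_copyI[OF pack G(1,3)])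
        fix e assume "e \<in> edges G"
        then obtain u v where uv: "(u, v) \<in> D" "e = {u, v}" using D(4) by auto
        then have "adj k Fs (x u) (x v)" using x(1) by (auto simp: H_def homs_def)
        then show "\<exists>i<k. x ` e \<in> edges (Fs i)" using uv by (simp add: adj_def)
      next
        fix e s assume "e \<in> edges G" "s \<in> verts G" "s \<notin> e"
        then have "(e, s) \<in> T" by (simp add: T_def X_def)
        then have "x \<notin> bad (e, s)" using x(2) by blast
        then show "\<not> touches_same_copy k Fs e s x" using xP by (simp add: bad_def)
      qed
      with none show False by simp
    qed
  qed
qed

section \<open>Large packings homomorphic to F\<close>

text \<open>A line is determined by its points over two distinct abscissas \<open>a\<close> and
  \<open>b\<close>; the subtraction takes place in the integers.\<close>

lemma add_mult_inj:
  fixes p q p' q' a b :: nat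
  assumes "p + a * q = p' + a * q'" "p + b * q = p' + b * q'" "a \<noteq> b"
  shows "p = p' \<and> q = q'"
proof -
  have "int p + int a * int q = int p' + int a * int q'" "int p + int b * int q = int p' + int b * int q'"
    using assms(1,2) by (simp_all flip: of_nat_mult of_nat_add)
  then have "(int a - int b) * (int q - int q') = 0" by (simp add: algebra_simps)
  then have "q = q'" using assms(3) by simp
  then show ?thesis using assms(1) by simp
qed

lemma mult_add_div: "r < b \<Longrightarrow> (c * b + r) div b = (c :: nat)"
  by simp

text \<open>An edge of \<open>F\<close> has ends in two different blocks, so a common edge of two
  copies gives two common points of their lines. Sending each block to its vertex of
  \<open>F\<close> is a homomorphism on the whole union.\<close>

lemma packing_homomorphic_to:
  fixes F :: "'a graph"
  assumes F: "simple_graph F" and n: "card (verts F) * card (verts F) * m \<le> n"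
  shows "\<exists>Fs. packing F n (m * m) Fs \<and> homomorphic_to (graph_Union (m * m) Fs) F"
proof -
  define f where "f = card (verts F)"
  have finF: "finite (verts F)" using F by (simp add: simple_graph_def)
  obtain idx where idx: "bij_betw idx (verts F) {0..<f}"
    using ex_bij_betw_finite_nat[OF finF] unfolding f_def by blast
  have idx_less: "idx v < f" if "v \<in> verts F" for v using bij_betwE[OF idx] that by auto
  have idx_inj: "u = v" if "u \<in> verts F" "v \<in> verts F" "idx u = idx v" for u v
    using idx that by (auto simp: bij_betw_def inj_on_def)
  \<comment> \<open>The number \<open>i\<close> encodes a line with intercept \<open>i div m\<close>
    and slope \<open>i mod m\<close>; \<open>idx v\<close> is both the number of the block and the
    abscissa.\<close>
  define emb where "emb i v = idx v * (f * m) + (i div m + idx v * (i mod m))" for i v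
  have offset: "i div m + idx v * (i mod m) < f * m" if i: "i < m * m" and v: "v \<in> verts F" for i v
  proof -
    have "m > 0" using i by (cases m) auto
    have "i div m < m" using i by (simp add: less_mult_imp_div_less)
    moreover have "idx v * (i mod m) \<le> idx v * m" using \<open>m > 0\<close> by (intro mult_left_mono) auto
    ultimately have "i div m + idx v * (i mod m) < Suc (idx v) * m"
      unfolding mult_Suc by (rule add_less_le_mono)
    also have "\<dots> \<le> f * m" using idx_less[OF v] by (intro mult_right_mono) auto
    finally show ?thesis .
  qed
  have emb_div: "emb i v div (f * m) = idx v" if "i < m * m" "v \<in> verts F" for i v
    unfolding emb_def by (rule mult_add_div[OF offset[OF that]])
  have emb_less: "emb i v < n" if "i < m * m" "v \<in> verts F" for i v
  proof -
    have "emb i v < Suc (idx v) * (f * m)" using offset[OF that] by (simp add: emb_def)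
    also have "\<dots> \<le> f * (f * m)" using idx_less[OF that(2)] by (intro mult_right_mono) auto
    also have "\<dots> \<le> n" using n by (simp add: f_def mult.assoc)
    finally show ?thesis .
  qed
  have emb_eq: "u = v" if "i < m * m" "j < m * m" "u \<in> verts F" "v \<in> verts F" "emb i u = emb j v" for i j u v
    using emb_div[of i u] emb_div[of j v] that idx_inj by simp
  have emb_inj: "inj_on (emb i) (verts F)" if "i < m * m" for i
    using emb_eq[OF that that] by (auto simp: inj_on_def)
  have F_edge: "e \<subseteq> verts F" "card e = 2" if "e \<in> edges F" for e
    using F that by (auto simp: simple_graph_def)
  define Fs where "Fs i = Graph (emb i ` verts F) ((`) (emb i) ` edges F)" for i
  have "packing F n (m * m) Fs"
    unfolding packing_def
  proof (intro conjI allI impI)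
    fix i assume i: "i < m * m"
    have card2: "card (emb i ` e) = 2" if "e \<in> edges F" for e
      using card_image[OF inj_on_subset[OF emb_inj[OF i] F_edge(1)[OF that]]] F_edge(2)[OF that] by simp
    have verts_sub: "emb i ` verts F \<subseteq> {..<n}" using emb_less[OF i] by auto
    have edge_sub: "emb i ` e \<subseteq> emb i ` verts F" if "e \<in> edges F" for e
      using F_edge(1)[OF that] by blast
    show "subgraph (Fs i) (complete_graph n)"
      unfolding subgraph_def simple_graph_def
    proof (intro conjI)
      show "finite (verts (Fs i))" using finF by (simp add: Fs_def)
      show "edges (Fs i) \<subseteq> {e. e \<subseteq> verts (Fs i) \<and> card e = 2}"
      proof
        fix e assume "e \<in> edges (Fs i)"
        then obtain e0 where "e0 \<in> edges F" "e = emb i ` e0" by (auto simp: Fs_def)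
        then show "e \<in> {e. e \<subseteq> verts (Fs i) \<and> card e = 2}" using card2 edge_sub by (simp add: Fs_def)
      qed
      show "verts (Fs i) \<subseteq> verts (complete_graph n)"
        using verts_sub by (simp add: Fs_def complete_graph_def)
      show "edges (Fs i) \<subseteq> edges (complete_graph n)"
      proof
        fix e assume "e \<in> edges (Fs i)"
        then obtain e0 where "e0 \<in> edges F" "e = emb i ` e0" by (auto simp: Fs_def)
        then have "card e = 2" "e \<subseteq> {..<n}" using card2 edge_sub verts_sub by blast+
        then show "e \<in> edges (complete_graph n)" by (simp add: complete_graph_def)
      qed
    qed
    show "isomorphic F (Fs i)"
      unfolding isomorphic_def
    proof (intro exI conjI ballI)
      show "bij_betw (emb i) (verts F) (verts (Fs i))" using emb_inj[OF i] by (simp add: Fs_def bij_betw_def)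
      fix u v assume uv: "u \<in> verts F" "v \<in> verts F"
      have "{u, v} \<in> edges F" if emb_uv: "{emb i u, emb i v} \<in> edges (Fs i)"
      proof -
        obtain e where e: "e \<in> edges F" "{emb i u, emb i v} = emb i ` e" using emb_uv by (auto simp: Fs_def)
        then have "emb i ` {u, v} = emb i ` e" by simp
        then have "{u, v} = e"
          using inj_on_image_eq_iff[OF emb_inj[OF i], of "{u, v}" e] uv F_edge(1)[OF e(1)] by simp
        then show ?thesis using e by simp
      qed
      moreover have "{emb i u, emb i v} \<in> edges (Fs i)" if "{u, v} \<in> edges F"
        using imageI[OF that, of "(`) (emb i)"] by (simp add: Fs_def)
      ultimately show "{u, v} \<in> edges F \<longleftrightarrow> {emb i u, emb i v} \<in> edges (Fs i)" by blast
    qed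
  next
    fix i j assume i: "i < m * m" and j: "j < m * m" and "i \<noteq> j"
    show "edges (Fs i) \<inter> edges (Fs j) = {}"
    proof (rule ccontr)
      assume "edges (Fs i) \<inter> edges (Fs j) \<noteq> {}"
      then obtain e e' where e: "e \<in> edges F" "e' \<in> edges F" "emb i ` e = emb j ` e'"
        by (auto simp: Fs_def)
      \<comment> \<open>A common vertex lies in a single block, so it represents the same vertex of
        \<open>F\<close> in both copies.\<close>
      have same: "emb i u = emb j u" if u: "u \<in> e" for u
      proof -
        have "emb i u \<in> emb j ` e'" using u e(3) by blast
        then obtain u' where u': "u' \<in> e'" "emb i u = emb j u'" by blast
        then have "u = u'" using emb_eq[OF i j, of u u'] u F_edge(1)[OF e(1)] F_edge(1)[OF e(2)] by blast
        with u' show ?thesis by simp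
      qed
      obtain u v where uv: "e = {u, v}" "u \<noteq> v" using F_edge(2)[OF e(1)] by (auto simp: card_2_iff)
      then have V: "u \<in> verts F" "v \<in> verts F" using F_edge(1)[OF e(1)] by auto
      have "idx u \<noteq> idx v" using idx_inj[OF V] uv by blast
      moreover have "i div m + idx u * (i mod m) = j div m + idx u * (j mod m)"
        "i div m + idx v * (i mod m) = j div m + idx v * (j mod m)"
        using same[of u] same[of v] uv by (simp_all add: emb_def)
      ultimately have "i div m = j div m \<and> i mod m = j mod m" using add_mult_inj by blast
      then have "i = j" by (metis div_mult_mod_eq)
      with \<open>i \<noteq> j\<close> show False by simp
    qed
  qed
  moreover have "homomorphic_to (graph_Union (m * m) Fs) F"
  proof -
    define \<pi> where "\<pi> x = inv_into (verts F) idx (x div (f * m))" for x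
    have \<pi>: "\<pi> (emb i v) = v" if "i < m * m" "v \<in> verts F" for i v
      using that idx by (simp add: \<pi>_def emb_div bij_betw_def)
    have "graph_hom \<pi> (graph_Union (m * m) Fs) F"
      unfolding graph_hom_def
    proof (intro conjI allI impI)
      show "\<pi> ` verts (graph_Union (m * m) Fs) \<subseteq> verts F"
        by (auto simp: graph_Union_def Fs_def \<pi>)
      fix x y assume "{x, y} \<in> edges (graph_Union (m * m) Fs)"
      then obtain i e where e: "i < m * m" "e \<in> edges F" "{x, y} = emb i ` e"
        by (auto simp: graph_Union_def Fs_def)
      have "\<pi> ` emb i ` e = (\<lambda>v. v) ` e"
        unfolding image_image using \<pi>[OF e(1)] F_edge(1)[OF e(2)] by (intro image_cong) auto
      then have "{\<pi> x, \<pi> y} = e" by (simp flip: e(3))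
      then show "{\<pi> x, \<pi> y} \<in> edges F" using e(2) by simp
    qed
    then show ?thesis unfolding homomorphic_to_def by blast
  qed
  ultimately show ?thesis by blast
qed

text \<open>A copy of \<open>G\<close> in the union composes with the map of the union to
  \<open>F\<close>. Hence the packing by lines is admissible whenever \<open>G\<close> does not map
  to \<open>F\<close>.\<close>

lemma multicolor_copy_homomorphic:
  fixes F :: "'a graph" and G :: "'b graph"
  assumes "has_multicolor_copy k Fs G" and hom: "homomorphic_to (graph_Union k Fs) F" and G: "simple_graph G"
  shows "homomorphic_to G F"
proof -
  obtain G' where G': "subgraph G' (graph_Union k Fs)" "isomorphic G G'"
    using assms(1) by (auto simp: has_multicolor_copy_def)
  obtain g where g: "bij_betw g (verts G) (verts G')"
    "\<forall>u\<in>verts G. \<forall>v\<in>verts G. {u, v} \<in> edges G \<longleftrightarrow> {g u, g v} \<in> edges G'"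
    using G'(2) unfolding isomorphic_def by blast
  obtain \<pi> where \<pi>: "graph_hom \<pi> (graph_Union k Fs) F" using hom by (auto simp: homomorphic_to_def)
  have "graph_hom (\<pi> \<circ> g) G F"
    unfolding graph_hom_def
  proof (intro conjI allI impI)
    show "(\<pi> \<circ> g) ` verts G \<subseteq> verts F"
      using g(1) G'(1) \<pi> unfolding graph_hom_def subgraph_def bij_betw_def by fastforce
    fix u v assume uv: "{u, v} \<in> edges G"
    then have "u \<in> verts G" "v \<in> verts G" using G by (auto simp: simple_graph_def)
    then have "{g u, g v} \<in> edges G'" using g(2) uv by blast
    then have "{g u, g v} \<in> edges (graph_Union k Fs)" using G'(1) by (auto simp: subgraph_def)
    then show "{(\<pi> \<circ> g) u, (\<pi> \<circ> g) v} \<in> edges F" using \<pi> by (simp add: graph_hom_def)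
  qed
  then show ?thesis unfolding homomorphic_to_def by blast
qed

section \<open>Growth of the extremal number\<close>

lemma no_isolated_imp_edges: "verts H \<noteq> {} \<Longrightarrow> \<nexists>v. isolated v H \<Longrightarrow> edges H \<noteq> {}"
  by (auto simp: isolated_def)

lemma multicolor_ex_attained:
  assumes "simple_graph F" "edges F \<noteq> {}" "simple_graph G" "edges G \<noteq> {}"
  obtains Fs where "packing F n (multicolor_ex F n G) Fs" "\<not> has_multicolor_copy (multicolor_ex F n G) Fs G"
proof -
  let ?K = "{k. \<exists>Fs. packing F n k Fs \<and> \<not> has_multicolor_copy k Fs G}"
  have "?K \<noteq> {}" using multicolor_ex_set_nonempty[OF assms(3,4)] by blast
  then have "multicolor_ex F n G \<in> ?K"
    unfolding multicolor_ex_def using multicolor_ex_set_finite[OF assms(1,2)] by (intro Max_in) auto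
  then show thesis using that by blast
qed

theorem theorem1:
  fixes F :: "'a graph" and G :: "'b graph"
  assumes "simple_graph F" and "verts F \<noteq> {}" and "\<nexists>v. isolated v F"
    and "simple_graph G" and "verts G \<noteq> {}" and "\<nexists>v. isolated v G"
  shows "((\<lambda>n. real (multicolor_ex F n G)) \<in> \<Theta>(\<lambda>n. real n ^ 2) \<longleftrightarrow> \<not> homomorphic_to G F) \<and>
    (homomorphic_to G F \<longrightarrow> (\<lambda>n. real (multicolor_ex F n G)) \<in> o(\<lambda>n. real n ^ 2))"
proof -
  let ?ex = "\<lambda>n. real (multicolor_ex F n G)"
  have edgesF: "edges F \<noteq> {}" and edgesG: "edges G \<noteq> {}"
    using no_isolated_imp_edges[OF assms(2,3)] no_isolated_imp_edges[OF assms(5,6)] .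
  note attained = multicolor_ex_attained[OF assms(1) edgesF assms(4) edgesG]
  have small: "?ex \<in> o(\<lambda>n. real n ^ 2)" if "homomorphic_to G F"
  proof (rule landau_o.smallI)
    fix c :: real assume "c > 0"
    obtain \<phi> where "graph_hom \<phi> G F" using \<open>homomorphic_to G F\<close> by (auto simp: homomorphic_to_def)
    from no_multicolor_copy_small[OF assms(1,4,5,6) this \<open>c > 0\<close>] obtain N
      where N: "\<And>n k Fs. n \<ge> N \<Longrightarrow> packing F n k Fs \<Longrightarrow> \<not> has_multicolor_copy k Fs G \<Longrightarrow> real k < c * real n ^ 2"
      by blast
    have "norm (?ex n) \<le> c * norm (real n ^ 2)" if "n \<ge> N" for n
    proof -
      obtain Fs where "packing F n (multicolor_ex F n G) Fs" "\<not> has_multicolor_copy (multicolor_ex F n G) Fs G"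
        by (rule attained)
      from N[OF \<open>n \<ge> N\<close> this] show ?thesis by simp
    qed
    then show "eventually (\<lambda>n. norm (?ex n) \<le> c * norm (real n ^ 2)) at_top"
      unfolding eventually_at_top_linorder by blast
  qed
  have big: "?ex \<in> \<Theta>(\<lambda>n. real n ^ 2)" if "\<not> homomorphic_to G F"
  proof (rule bigthetaI)
    have "multicolor_ex F n G \<le> n\<^sup>2" for n
    proof -
      obtain Fs where "packing F n (multicolor_ex F n G) Fs"
        by (rule attained)
      then show ?thesis by (rule packing_le_square[OF _ assms(1) edgesF])
    qed
    then have "norm (?ex n) \<le> 1 * norm (real n ^ 2)" for n
      by (simp flip: of_nat_power)
    then show "?ex \<in> O(\<lambda>n. real n ^ 2)" by (intro landau_o.bigI[of 1] always_eventually) auto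
    define s where "s = card (verts F) * card (verts F)"
    have s: "s > 0" using assms(1,2) by (simp add: s_def simple_graph_def card_gt_0_iff)
    \<comment> \<open>With \<open>m = n div s\<close> and \<open>n \<ge> s\<close>, rounding down at
      most halves: \<open>n \<le> 2 * s * m\<close>. The square of this gives the constant.\<close>
    have "norm (?ex n) \<ge> 1 / (4 * real s ^ 2) * norm (real n ^ 2)" if "n \<ge> s" for n
    proof -
      define m where "m = n div s"
      have "s * m \<le> n" by (simp add: m_def)
      then obtain Fs where Fs: "packing F n (m * m) Fs" "homomorphic_to (graph_Union (m * m) Fs) F"
        using packing_homomorphic_to[OF assms(1), of m n] unfolding s_def by blast
      then have "\<not> has_multicolor_copy (m * m) Fs G"
        using multicolor_copy_homomorphic assms(4) \<open>\<not> homomorphic_to G F\<close> by blast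
      with Fs(1) have "m * m \<le> multicolor_ex F n G"
        unfolding multicolor_ex_def using multicolor_ex_set_finite[OF assms(1) edgesF]
        by (intro Max_ge) auto
      then have lower: "real (m * m) \<le> ?ex n" by (simp only: of_nat_le_iff)
      have "real n \<le> real (2 * s * m)"
      proof -
        have "m \<ge> 1" using that s by (simp add: m_def div_greater_zero_iff Suc_le_eq)
        have "n = s * m + n mod s" by (simp add: m_def)
        then have "n < s * m + s" using mod_less_divisor[OF s, of n] by linarith
        moreover have "s \<le> s * m" using \<open>m \<ge> 1\<close> by simp
        ultimately have "n \<le> 2 * s * m" by linarith
        then show ?thesis by (simp only: of_nat_le_iff)
      qed
      then have "real n ^ 2 \<le> real (2 * s * m) ^ 2" by (intro power_mono) auto
      then have "1 / (4 * real s ^ 2) * real n ^ 2 \<le> 1 / (4 * real s ^ 2) * real (2 * s * m) ^ 2"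
        by (intro mult_left_mono) auto
      also have "\<dots> = real (m * m)" using s by (simp add: power2_eq_square)
      also note lower
      finally show ?thesis by simp
    qed
    then show "?ex \<in> \<Omega>(\<lambda>n. real n ^ 2)"
      using s by (intro landau_omega.bigI[of "1 / (4 * real s ^ 2)"])
        (simp, unfold eventually_at_top_linorder, blast)
  qed
  \<comment> \<open>Both growth rates together would make \<open>n\<^sup>2\<close> negligible
    against itself, hence eventually zero.\<close>
  have "?ex \<notin> \<Theta>(\<lambda>n. real n ^ 2)" if "homomorphic_to G F"
  proof
    assume "?ex \<in> \<Theta>(\<lambda>n. real n ^ 2)"
    then have "(\<lambda>n. real n ^ 2) \<in> O(?ex)" by (simp add: bigtheta_def bigomega_iff_bigo)
    from landau_o.big_small_trans[OF this small[OF that]]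
    have "eventually (\<lambda>n. real n ^ 2 = 0) at_top" by (simp add: landau_o.small_refl_iff)
    then obtain N where "\<And>n. n \<ge> N \<Longrightarrow> real n ^ 2 = 0" by (auto simp: eventually_at_top_linorder)
    from this[of "Suc N"] show False by simp
  qed
  then show ?thesis using small big by blast
qed

end
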